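(* For every fixed labeled tree $T\in\mathcal T_n$, there exists $c_T>0$ such that $$0\le 1-\frac{\mu_T(m)}{m^{m-2}}=O_T(e^{-c_Tm})\qquad(m\to\infty),$$ where the implied constant depends only on $T$.
   Context: $[m]=\{1,\dots,m\}$, and $\mathcal T_m$ is the set of trees with vertex set $[m]$ (labeled trees). Let $T\in\mathcal T_n$, $U\in\mathcal T_m$. A display of $T$ in $U$ is a pair $(R,q)$ where $R=\{r_1<\cdots<r_n\}\subseteq[m]$ is an $n$-element set and $q:[m]\to R$ is a retraction ($q(r)=r$ for $r\in R$) such that (1) every fiber $q^{-1}(r_i)$ induces a connected subtree of $U$; (2) after each fiber is contracted to one vertex, the quotient tree, with the vertex coming from $q^{-1}(r_i)$ labeled $i$, is equal to $T$. Write $T\preceq U$ when $U$ admits at least one display of $T$. The support count is $\mu_T(m)=\#\{U\in\mathcal T_m: T\preceq U\}$. *)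

theory Defs
  imports
    "Graph_Theory.Digraph_Component"
    "HOL-Library.FuncSet"
    "HOL-Library.Landau_Symbols"
begin

text \<open>
  In \<open>Graph_Theory\<close>, a finite simple undirected graph is a finite, loop-free digraph without
  parallel arcs whose arc relation is symmetric (locale \<open>pair_graph\<close>); each edge is present as two
  opposite arcs. Its predicate \<open>tree\<close> forbids directed cycles, hence also \<open>u \<rightarrow> v \<rightarrow> u\<close>, so it is not
  the notion of an undirected tree. In a symmetric loop-free digraph the undirected cycles are
  exactly the directed cycles of length at least 3.
  Since \<open>connected\<close> demands a nonempty vertex set, there is no tree on 0 vertices.
\<close>

definition undirected_tree :: "'a pair_pre_digraph \<Rightarrow> bool" where
  "undirected_tree G \<longleftrightarrow>
     pair_graph G \<and> Digraph_Component.connected (with_proj G) \<and>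
     \<not> (\<exists>p. pre_digraph.cycle (with_proj G) p \<and> 3 \<le> length p)"

definition labeled_trees :: "nat \<Rightarrow> nat pair_pre_digraph set" where
  "labeled_trees m = {T. undirected_tree T \<and> pverts T = {1..m}}"

text \<open>The elements of \<open>R\<close> in increasing order are \<open>ranked R 1 < \<dots> < ranked R (card R)\<close>.\<close>

definition ranked :: "nat set \<Rightarrow> nat \<Rightarrow> nat" where
  "ranked R i = sorted_list_of_set R ! (i - 1)"

definition fiber :: "nat pair_pre_digraph \<Rightarrow> (nat \<Rightarrow> nat) \<Rightarrow> nat \<Rightarrow> nat set" where
  "fiber U q r = {x \<in> pverts U. q x = r}"

text \<open>The graph obtained from \<open>U\<close> by contracting each fiber of \<open>q\<close>; the vertex
  coming from the fiber over the \<open>i\<close>-th smallest element of \<open>R\<close> is named \<open>i\<close>.\<close>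

definition contraction ::
  "nat pair_pre_digraph \<Rightarrow> nat set \<Rightarrow> (nat \<Rightarrow> nat) \<Rightarrow> nat pair_pre_digraph" where
  "contraction U R q =
     \<lparr> pverts = {1..card R},
       parcs = {(i, j). i \<in> {1..card R} \<and> j \<in> {1..card R} \<and> i \<noteq> j \<and>
                  (\<exists>x \<in> fiber U q (ranked R i). \<exists>y \<in> fiber U q (ranked R j). (x, y) \<in> parcs U)} \<rparr>"

text \<open>For a tree \<open>U\<close>, a connected induced subgraph
  is the same as an induced subtree.\<close>

definition is_display ::
  "nat pair_pre_digraph \<Rightarrow> nat pair_pre_digraph \<Rightarrow> nat set \<times> (nat \<Rightarrow> nat) \<Rightarrow> bool" where
  "is_display T U = (\<lambda>(R, q).
     R \<subseteq> pverts U \<and> card R = card (pverts T) \<and>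
     q \<in> pverts U \<rightarrow>\<^sub>E R \<and> (\<forall>r \<in> R. q r = r) \<and>
     (\<forall>r \<in> R. Digraph_Component.connected (with_proj U \<restriction> fiber U q r)) \<and>
     contraction U R q = T)"

definition displayed_in :: "nat pair_pre_digraph \<Rightarrow> nat pair_pre_digraph \<Rightarrow> bool"
    (infix \<open>\<preceq>\<close> 50) where
  "T \<preceq> U \<longleftrightarrow> (\<exists>d. is_display T U d)"

definition support_count :: "nat pair_pre_digraph \<Rightarrow> nat \<Rightarrow> nat" (\<open>\<mu>\<close>) where
  "\<mu> T m = card {U \<in> labeled_trees m. T \<preceq> U}"

end

theory Submission
  imports Defs
begin

text \<open>
  Let \<open>T\<close> have \<open>n\<close> vertices and root it at \<open>n\<close>; root every tree \<open>U\<close> on \<open>{1..m}\<close> at \<open>m\<close>. Suppose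
  that \<open>U\<close> has a vertex other than \<open>m\<close> whose set \<open>S\<close> of descendants has \<open>n\<close> elements, and that the increasing
  bijection \<open>{1..n} \<rightarrow> S\<close> turns \<open>T\<close> into the subtree below this vertex. Then \<open>T \<preceq> U\<close>: take \<open>R = S\<close>,
  let every vertex of \<open>S\<close> other than its root be a fiber of its own, and collapse the rest of \<open>U\<close>
  into the root of \<open>S\<close> (\<open>pendant_copy_displayed\<close>). So it suffices that exponentially few trees
  have no such pendant copy of \<open>T\<close>.

  Rooted trees are treated as parent functions. They are in bijection with the labeled trees
  (\<open>labeled_trees_eq\<close>), and counting them by their first layer gives Cayley's formula
  (\<open>card_forests\<close>), which is needed exactly: it turns \<open>1 - \<mu> T m / m ^ (m - 2)\<close> into the
  proportion of trees that do not display \<open>T\<close>, which also makes it nonnegative.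

  The trees without a pendant copy are counted by a generating function argument. All labeled rooted
  trees have the exponential generating function \<open>Y = x e\<^sup>Y\<close>, with radius of convergence \<open>1/e\<close>
  and \<open>Y(1/e) = 1\<close>. Forbidding one structure on each \<open>n\<close>-set of labels changes this equation to
  \<open>Y = x e\<^sup>Y - x\<^sup>n / n!\<close>. At \<open>x = 1/e\<close> the value \<open>1\<close> is now a strict supersolution, because
  \<open>x e - x\<^sup>n / n! < 1\<close>. By continuity it remains one for some \<open>x > 1/e\<close>, so the series still
  converges there. Its coefficients are therefore exponentially smaller than those of the full
  series, whose growth is that of \<open>m ^ m / m!\<close>, up to powers of \<open>m\<close>. Formally, the recurrence for
  the numbers of forests (\<open>card_avoiders_le\<close>) bounds the partial sums of the series inductively
  (\<open>avoider_bound_growth\<close>).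
\<close>

section \<open>Forests as acyclic parent functions\<close>

text \<open>
  On a finite set this says that iterating \<open>f\<close> leaves \<open>A\<close> from every starting point. The formulation
  by subsets avoids iterates, whose values outside \<open>A\<close> would be arbitrary, and passes to subsets of
  \<open>A\<close> for free.
\<close>

definition acyclic_on :: "'a set \<Rightarrow> ('a \<Rightarrow> 'a) \<Rightarrow> bool" where
  "acyclic_on A f \<longleftrightarrow> (\<forall>X\<subseteq>A. X \<noteq> {} \<longrightarrow> (\<exists>x\<in>X. f x \<notin> X))"

text \<open>
  For disjoint \<open>A\<close> and \<open>B\<close>, the rooted forests with vertex set \<open>A \<union> B\<close> and set of roots \<open>B\<close>; each is
  given by the parents of the elements of \<open>A\<close>.
\<close>

definition forests :: "'a set \<Rightarrow> 'a set \<Rightarrow> ('a \<Rightarrow> 'a) set" where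
  "forests A B = {f \<in> A \<rightarrow>\<^sub>E A \<union> B. acyclic_on A f}"

lemma acyclic_on_mono: "acyclic_on A f \<Longrightarrow> A' \<subseteq> A \<Longrightarrow> acyclic_on A' f"
  unfolding acyclic_on_def by (meson subset_trans)

lemma acyclic_on_cong: "(\<And>x. x \<in> A \<Longrightarrow> f x = g x) \<Longrightarrow> acyclic_on A f \<longleftrightarrow> acyclic_on A g"
  unfolding acyclic_on_def by (metis subsetD)

lemma acyclic_onE:
  assumes "acyclic_on A f" "X \<subseteq> A" "X \<noteq> {}"
  obtains x where "x \<in> X" "f x \<notin> X"
  using assms unfolding acyclic_on_def by blast

text \<open>
  A set that meets the layer \<open>A - C\<close> is left by any of its points there, and the other sets lie in \<open>C\<close>.
\<close>

lemma acyclic_onI_layer: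
  assumes "\<And>x. x \<in> A - C \<Longrightarrow> f x \<notin> A" "acyclic_on C f"
  shows "acyclic_on A f"
  unfolding acyclic_on_def
proof (intro allI impI)
  fix X assume X: "X \<subseteq> A" "X \<noteq> {}"
  show "\<exists>x\<in>X. f x \<notin> X"
  proof (cases "X \<subseteq> C")
    case True
    then show ?thesis using assms(2) X unfolding acyclic_on_def by blast
  next
    case False
    then show ?thesis using assms(1) X by blast
  qed
qed

lemma finite_forests [simp]: "finite A \<Longrightarrow> finite B \<Longrightarrow> finite (forests A B)"
  unfolding forests_def by (rule finite_subset[of _ "A \<rightarrow>\<^sub>E A \<union> B"]) (auto intro!: finite_PiE)

lemma forests_empty [simp]: "forests {} B = {\<lambda>_. undefined}"
  by (auto simp: forests_def acyclic_on_def)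

lemma forests_mapsto: "f \<in> forests A B \<Longrightarrow> x \<in> A \<Longrightarrow> f x \<in> A \<union> B"
  unfolding forests_def by (drule CollectD, erule conjE, rule PiE_mem)

lemma restrict_forests:
  assumes "f \<in> forests A B" "C \<subseteq> A" "\<And>x. x \<in> C \<Longrightarrow> f x \<in> C \<union> D"
  shows "restrict f C \<in> forests C D"
proof -
  have "acyclic_on C f" using assms acyclic_on_mono unfolding forests_def by blast
  then have "acyclic_on C (restrict f C)" using acyclic_on_cong[of C f "restrict f C"] by simp
  then show ?thesis using assms unfolding forests_def by auto
qed


section \<open>The number of forests\<close>

text \<open>
  Deleting the roots \<open>B\<close> leaves a forest whose roots are their children \<open>L\<close>.
\<close>

lemma bij_betw_layer_decomposition:
  assumes "A \<inter> B = {}"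
  shows "bij_betw (\<lambda>f. ({x\<in>A. f x \<in> B}, restrict f {x\<in>A. f x \<in> B}, restrict f {x\<in>A. f x \<notin> B}))
    (forests A B) (SIGMA L:Pow A. (L \<rightarrow>\<^sub>E B) \<times> forests (A - L) L)"
    (is "bij_betw ?F _ ?S")
proof (rule bij_betw_byWitness[where f' = "\<lambda>(L, g, h) x. if x \<in> L then g x else h x"])
  show "\<forall>f\<in>forests A B. (\<lambda>(L, g, h) x. if x \<in> L then g x else h x) (?F f) = f"
  proof (intro ballI ext)
    fix f x assume "f \<in> forests A B"
    then have "f x = undefined" if "x \<notin> A" using that by (auto simp: forests_def)
    then show "(case ?F f of (L, g, h) \<Rightarrow> \<lambda>x. if x \<in> L then g x else h x) x = f x" by simp
  qed
  show "?F ` forests A B \<subseteq> ?S"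
  proof (rule image_subsetI)
    fix f assume f: "f \<in> forests A B"
    let ?L = "{x\<in>A. f x \<in> B}"
    have "restrict f (A - ?L) \<in> forests (A - ?L) ?L"
      using f by (intro restrict_forests[OF f]) (auto simp: forests_def)
    moreover have "A - ?L = {x\<in>A. f x \<notin> B}" by auto
    ultimately have "restrict f {x\<in>A. f x \<notin> B} \<in> forests (A - ?L) ?L" by simp
    then show "?F f \<in> ?S" by (simp add: restrict_PiE_iff)
  qed
  have *: "(\<lambda>x. if x \<in> L then g x else h x) \<in> forests A B \<and>
      {x\<in>A. (if x \<in> L then g x else h x) \<in> B} = L"
    if L: "L \<subseteq> A" and g: "g \<in> L \<rightarrow>\<^sub>E B" and h: "h \<in> forests (A - L) L" for L g h
  proof -
    let ?f = "\<lambda>x. if x \<in> L then g x else h x"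
    have "acyclic_on (A - L) ?f"
      using h acyclic_on_cong[of "A - L" ?f h] by (simp add: forests_def)
    then have "acyclic_on A ?f"
      by (rule acyclic_onI_layer[rotated]) (use L g assms in auto)
    moreover have "?f \<in> A \<rightarrow>\<^sub>E A \<union> B" using L g h by (fastforce simp: forests_def PiE_iff extensional_def)
    moreover have "h x \<in> A" if "x \<in> A - L" for x using h that L by (auto simp: forests_def)
    then have "{x\<in>A. ?f x \<in> B} = L" using L g assms by (fastforce split: if_splits)
    ultimately show ?thesis using \<open>{x\<in>A. ?f x \<in> B} = L\<close> by (simp add: forests_def)
  qed
  then show "(\<lambda>(L, g, h) x. if x \<in> L then g x else h x) ` ?S \<subseteq> forests A B" by auto
  show "\<forall>t\<in>?S. ?F ((\<lambda>(L, g, h) x. if x \<in> L then g x else h x) t) = t"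
  proof (rule ballI)
    fix t assume "t \<in> ?S"
    then obtain L g h where t': "t = (L, g, h)"
      and t: "L \<subseteq> A" "g \<in> L \<rightarrow>\<^sub>E B" "h \<in> forests (A - L) L" by auto
    let ?f = "\<lambda>x. if x \<in> L then g x else h x"
    have L: "{x\<in>A. ?f x \<in> B} = L" using *[OF t] by simp
    then have L': "{x\<in>A. ?f x \<notin> B} = A - L" by blast
    have "restrict ?f L x = g x" for x using t(2) by (cases "x \<in> L") auto
    then have g: "restrict ?f L = g" by blast
    have "restrict ?f (A - L) x = h x" for x using t(3) by (cases "x \<in> A - L") (auto simp: forests_def)
    then have h: "restrict ?f (A - L) = h" by blast
    show "?F ((\<lambda>(L, g, h) x. if x \<in> L then g x else h x) t) = t"
      unfolding t' prod.case L L' g h by (rule refl)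
  qed
qed

lemma sum_Pow_card:
  fixes g :: "nat \<Rightarrow> 'b :: comm_semiring_1"
  assumes "finite A"
  shows "(\<Sum>L\<in>Pow A. g (card L)) = (\<Sum>k\<le>card A. of_nat (card A choose k) * g k)"
proof -
  have "(\<Sum>L\<in>Pow A. g (card L)) = (\<Sum>k\<le>card A. \<Sum>L\<in>{L\<in>Pow A. card L = k}. g (card L))"
    using assms by (intro sum.group[symmetric]) (auto intro: card_mono)
  also have "\<dots> = (\<Sum>k\<le>card A. of_nat (card {L. L \<subseteq> A \<and> card L = k}) * g k)" by simp
  finally show ?thesis using n_subsets[OF assms] by simp
qed

text \<open>
  Cayley's formula for rooted forests. Sorting the forests by their first layer turns the induction
  step into the binomial theorem, thanks to
  \<open>l * (Suc a choose l) = Suc a * (a choose (l - 1))\<close>. The case \<open>A = {}\<close> is separate because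
  \<open>card A - 1\<close> truncates.
\<close>

lemma card_forests:
  assumes "finite A" "finite B" "A \<inter> B = {}"
  shows "card (forests A B) = (if A = {} then 1 else card B * (card A + card B) ^ (card A - 1))"
  using assms
proof (induction "card A" arbitrary: A B rule: less_induct)
  case less
  show ?case
  proof (cases "A = {}")
    case False
    then obtain a where a: "card A = Suc a" using less.prems by (cases "card A") auto
    let ?b = "card B"
    \<comment> \<open>The number of forests on the remaining \<open>Suc a - l\<close> vertices whose roots are the \<open>l\<close> vertices of the first layer.\<close>
    define N where "N l = (if l = 0 then 0 else if l = Suc a then 1 else l * Suc a ^ (a - l))" for l
    have N: "card (forests (A - L) L) = N (card L)" if "L \<subseteq> A" for L
    proof (cases "L = {}")
      case True
      have "forests A {} = {}"
        using False by (auto simp: forests_def acyclic_on_def PiE_iff)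
      then show ?thesis using True by (simp add: N_def)
    next
      case False
      have L: "finite L" "card L \<le> Suc a"
        using that less.prems a by (auto intro: finite_subset card_mono simp flip: a)
      have cd: "card (A - L) = Suc a - card L" using that L a card_Diff_subset by metis
      moreover have "A - L = {} \<longleftrightarrow> card L = Suc a"
        using cd L(2) card_0_eq[of "A - L"] less.prems(1) by auto
      moreover have "card L > 0" using False L by (simp add: card_gt_0_iff)
      ultimately show ?thesis
        using less.hyps[of "A - L" L] less.prems(1) L a Diff_disjoint[of L A]
        by (auto simp: N_def Int_commute)
    qed
    have "card (forests A B) = card (SIGMA L:Pow A. (L \<rightarrow>\<^sub>E B) \<times> forests (A - L) L)"
      using bij_betw_layer_decomposition[OF less.prems(3)] by (rule bij_betw_same_card)
    also have "\<dots> = (\<Sum>L\<in>Pow A. card ((L \<rightarrow>\<^sub>E B) \<times> forests (A - L) L))"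
      using less.prems finite_subset
      by (intro card_SigmaI ballI finite_cartesian_product finite_PiE finite_forests) blast+
    also have "\<dots> = (\<Sum>L\<in>Pow A. ?b ^ card L * N (card L))"
      using less.prems N
      by (intro sum.cong refl) (simp add: card_cartesian_product card_funcsetE finite_subset[of _ A])
    also have "\<dots> = (\<Sum>k\<le>Suc a. (Suc a choose k) * (?b ^ k * N k))"
      using sum_Pow_card[OF less.prems(1), of "\<lambda>k. ?b ^ k * N k"] a by simp
    also have "\<dots> = (\<Sum>k\<le>a. (Suc a choose Suc k) * (?b ^ Suc k * N (Suc k)))"
      by (subst sum.atMost_Suc_shift) (simp add: N_def)
    also have "\<dots> = (\<Sum>k\<le>a. ?b * ((a choose k) * ?b ^ k * Suc a ^ (a - k)))"
    proof (intro sum.cong refl)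
      fix k assume k: "k \<in> {..a}"
      have "(Suc a choose Suc k) * N (Suc k) = (a choose k) * Suc a ^ (a - k)"
      proof (cases "k = a")
        case False
        then have "a - k = Suc (a - Suc k)" using k by auto
        have "(Suc a choose Suc k) * N (Suc k) = (Suc k * (Suc a choose Suc k)) * Suc a ^ (a - Suc k)"
          using False by (simp add: N_def algebra_simps)
        also have "\<dots> = (Suc a * (a choose k)) * Suc a ^ (a - Suc k)"
          by (simp only: Suc_times_binomial)
        finally show ?thesis by (simp only: \<open>a - k = _\<close> power_Suc mult_ac)
      qed (simp add: N_def)
      then have "((Suc a choose Suc k) * N (Suc k)) * ?b ^ Suc k = ((a choose k) * Suc a ^ (a - k)) * ?b ^ Suc k"
        by (rule arg_cong)
      then show "(Suc a choose Suc k) * (?b ^ Suc k * N (Suc k)) = ?b * ((a choose k) * ?b ^ k * Suc a ^ (a - k))"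
        by (simp only: power_Suc mult_ac)
    qed
    also have "\<dots> = ?b * (?b + Suc a) ^ a"
      by (subst binomial) (simp add: sum_distrib_left)
    finally have "card (forests A B) = ?b * (?b + Suc a) ^ a" .
    then show ?thesis using False by (simp only: a add.commute[of ?b] if_False diff_Suc_1)
  qed simp
qed

section \<open>Forests without a pendant copy\<close>

text \<open>
  The recurrence for the number of rooted forests on \<open>a\<close> vertices in which, on each \<open>n\<close>-set of labels,
  one rooted tree is forbidden as a pendant subtree. The vertices sharing a tree with a
  distinguished vertex form a set of size \<open>Suc k\<close>; the tree on them is a root together with a forest
  on the remaining \<open>k\<close> vertices. Only trees of size exactly \<open>n\<close> can be the forbidden one.
\<close>

fun avoider_bound :: "nat \<Rightarrow> nat \<Rightarrow> nat" where
  "avoider_bound n 0 = 1"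
| "avoider_bound n (Suc a) = (\<Sum>k\<le>a. (a choose k) *
     (Suc k * avoider_bound n k - (if Suc k = n then 1 else 0)) * avoider_bound n (a - k))"

text \<open>
  The count depends only on each \<open>n\<close>-set \<open>S\<close> carrying exactly one forbidden rooted tree. It is given
  here by its root \<open>p S\<close> and its parent function \<open>h S\<close>.
\<close>

locale pattern =
  fixes n :: nat and p :: "'a set \<Rightarrow> 'a" and h :: "'a set \<Rightarrow> 'a \<Rightarrow> 'a"
  assumes root_in: "finite S \<Longrightarrow> card S = n \<Longrightarrow> p S \<in> S"
    and parent_forest: "finite S \<Longrightarrow> card S = n \<Longrightarrow> h S \<in> forests (S - {p S}) {p S}"
begin

definition pendant_copy :: "'a set \<Rightarrow> ('a \<Rightarrow> 'a) \<Rightarrow> 'a set \<Rightarrow> bool" where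
  "pendant_copy A f S \<longleftrightarrow> S \<subseteq> A \<and> card S = n \<and> f (p S) \<notin> S \<and>
     (\<forall>x\<in>S - {p S}. f x = h S x) \<and> (\<forall>x\<in>A - S. f x \<notin> S)"

definition avoiders :: "'a set \<Rightarrow> 'a \<Rightarrow> ('a \<Rightarrow> 'a) set" where
  "avoiders A \<rho> = {f \<in> forests A {\<rho>}. \<nexists>S. pendant_copy A f S}"

text \<open>
  A rooted tree on \<open>S\<close> is given by its root and the parent function on the other vertices.
\<close>

definition avoiding_trees :: "'a set \<Rightarrow> ('a \<times> ('a \<Rightarrow> 'a)) set" where
  "avoiding_trees S = (SIGMA r:S. avoiders (S - {r}) r) - (if card S = n then {(p S, h S)} else {})"

end

text \<open>
  The set \<open>S\<close> is the vertex set of the tree that contains \<open>a\<close>, and \<open>r\<close> is the child of \<open>\<rho>\<close> at its top.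
\<close>

lemma forest_component:
  assumes f: "f \<in> forests A {\<rho>}" and \<rho>: "\<rho> \<notin> A" and a: "a \<in> A"
  obtains S r where "S \<subseteq> A" "a \<in> S" "r \<in> S" "f r = \<rho>"
    "\<And>x. x \<in> S - {r} \<Longrightarrow> f x \<in> S" "\<And>x. x \<in> A - S \<Longrightarrow> f x \<notin> S"
proof -
  define E where "E = {(x, f x) | x. x \<in> A}"
  have maps: "f x \<in> insert \<rho> A" if "x \<in> A" for x using f that by (auto simp: forests_def)
  obtain r where r: "r \<in> A" "(a, r) \<in> E\<^sup>*" "f r = \<rho>"
  proof -
    have "acyclic_on A f" using f by (simp add: forests_def)
    then obtain r where r: "r \<in> {x\<in>A. (a, x) \<in> E\<^sup>*}" "f r \<notin> {x\<in>A. (a, x) \<in> E\<^sup>*}"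
      by (rule acyclic_onE[of A f "{x\<in>A. (a, x) \<in> E\<^sup>*}"]) (use a in auto)
    then have "(a, f r) \<in> E\<^sup>*" by (auto simp: E_def intro: rtrancl_into_rtrancl)
    then have "f r = \<rho>" using r maps by blast
    then show thesis using r that by blast
  qed
  show thesis
  proof (rule that[of "{x\<in>A. (x, r) \<in> E\<^sup>*}" r])
    fix x assume "x \<in> {x\<in>A. (x, r) \<in> E\<^sup>*} - {r}"
    then have x: "x \<in> A" "(x, r) \<in> E\<^sup>*" "x \<noteq> r" by auto
    then have fx: "(f x, r) \<in> E\<^sup>*" by (auto simp: E_def elim: converse_rtranclE)
    have "(\<rho>, r) \<notin> E\<^sup>*"
      using \<rho> r(1) by (auto simp: E_def elim: converse_rtranclE)
    then show "f x \<in> {x\<in>A. (x, r) \<in> E\<^sup>*}" using fx maps[OF x(1)] by auto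
  next
    fix x assume "x \<in> A - {x\<in>A. (x, r) \<in> E\<^sup>*}"
    then show "f x \<notin> {x\<in>A. (x, r) \<in> E\<^sup>*}"
      by (auto simp: E_def intro: converse_rtrancl_into_rtrancl)
  qed (use a r in auto)
qed

context pattern begin

lemma finite_avoiders: "finite A \<Longrightarrow> finite (avoiders A \<rho>)"
  unfolding avoiders_def by simp

lemma finite_avoiding_trees: "finite S \<Longrightarrow> finite (avoiding_trees S)"
  unfolding avoiding_trees_def by (intro finite_Diff finite_SigmaI finite_avoiders) auto

text \<open>
  If no vertex outside \<open>C\<close> has its parent in \<open>C\<close>, then what is pendant in the restriction to \<open>C\<close> is
  pendant in the whole forest.
\<close>

lemma restrict_avoiders:
  assumes f: "f \<in> avoiders A \<rho>" and C: "C \<subseteq> A" "\<And>x. x \<in> C \<Longrightarrow> f x \<in> insert r C" "r \<notin> C"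
    and out: "\<And>x. x \<in> A - C \<Longrightarrow> f x \<notin> C" and fin: "finite A"
  shows "restrict f C \<in> avoiders C r"
proof -
  have "restrict f C \<in> forests C {r}"
    using f C by (intro restrict_forests[of f A "{\<rho>}"]) (auto simp: avoiders_def)
  moreover have "\<not> pendant_copy C (restrict f C) S" for S
  proof
    assume S: "pendant_copy C (restrict f C) S"
    then have "card S = n" "S \<subseteq> A" using C(1) by (auto simp: pendant_copy_def)
    then have "finite S" using fin by (simp add: finite_subset)
    then have "p S \<in> S" using \<open>card S = n\<close> by (rule root_in)
    have SC: "S \<subseteq> C" using S by (simp add: pendant_copy_def)
    have "f x = h S x" if "x \<in> S - {p S}" for x
      using S SC that unfolding pendant_copy_def by (metis Diff_iff restrict_apply' subsetD)
    moreover have "f (p S) \<notin> S" using S SC \<open>p S \<in> S\<close> by (auto simp: pendant_copy_def)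
    moreover have "f x \<notin> S" if "x \<in> A - S" for x
    proof (cases "x \<in> C")
      case True
      then show ?thesis using S that unfolding pendant_copy_def by (metis Diff_iff restrict_apply')
    next
      case False
      then show ?thesis using out SC that by blast
    qed
    ultimately have "pendant_copy A f S"
      using SC C(1) \<open>card S = n\<close> by (auto simp: pendant_copy_def)
    then show False using f by (auto simp: avoiders_def)
  qed
  ultimately show ?thesis by (auto simp: avoiders_def)
qed

text \<open>
  Split off the tree containing \<open>a\<close>. This tree is not itself forbidden, for its vertex set is closed
  under taking children, so that it would be a pendant copy.
\<close>

lemma avoiders_decomposition:
  assumes fin: "finite A" and \<rho>: "\<rho> \<notin> A" and a: "a \<in> A"
  shows "avoiders A \<rho> \<subseteq> (\<lambda>(S, (r, g), k) x. if x = r then \<rho> else if x \<in> S then g x else k x) `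
    (SIGMA S:{S\<in>Pow A. a \<in> S}. avoiding_trees S \<times> avoiders (A - S) \<rho>)"
proof
  fix f assume f: "f \<in> avoiders A \<rho>"
  then have ff: "f \<in> forests A {\<rho>}" by (simp add: avoiders_def)
  obtain S r where S: "S \<subseteq> A" "a \<in> S" "r \<in> S" "f r = \<rho>"
    "\<And>x. x \<in> S - {r} \<Longrightarrow> f x \<in> S" "\<And>x. x \<in> A - S \<Longrightarrow> f x \<notin> S"
    using forest_component[OF ff \<rho> a] by blast
  have maps: "f x \<in> insert \<rho> A" if "x \<in> A" for x using ff that by (auto simp: forests_def)
  have 1: "restrict f (A - S) \<in> avoiders (A - S) \<rho>"
    using S \<rho> maps by (intro restrict_avoiders[OF f _ _ _ _ fin]) blast+
  have 2: "restrict f (S - {r}) \<in> avoiders (S - {r}) r"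
    using S \<rho> by (intro restrict_avoiders[OF f _ _ _ _ fin]) blast+
  have 3: "(r, restrict f (S - {r})) \<noteq> (p S, h S)" if "card S = n"
  proof
    assume eq: "(r, restrict f (S - {r})) = (p S, h S)"
    then have "f x = h S x" if "x \<in> S - {p S}" for x using that by (metis prod.inject restrict_apply')
    then have "pendant_copy A f S" using eq S \<rho> \<open>card S = n\<close> by (auto simp: pendant_copy_def)
    then show False using f by (auto simp: avoiders_def)
  qed
  have eq: "f = (\<lambda>x. if x = r then \<rho> else if x \<in> S then restrict f (S - {r}) x else restrict f (A - S) x)"
  proof
    fix x
    have "f x = undefined" if "x \<notin> A" using that ff by (auto simp: forests_def)
    then show "f x = (if x = r then \<rho> else if x \<in> S then restrict f (S - {r}) x else restrict f (A - S) x)"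
      using S(4) by simp
  qed
  have mem: "(S, (r, restrict f (S - {r})), restrict f (A - S)) \<in>
     (SIGMA S:{S\<in>Pow A. a \<in> S}. avoiding_trees S \<times> avoiders (A - S) \<rho>)"
    using 1 2 3 S by (auto simp: avoiding_trees_def)
  show "f \<in> (\<lambda>(S, (r, g), k) x. if x = r then \<rho> else if x \<in> S then g x else k x) `
    (SIGMA S:{S\<in>Pow A. a \<in> S}. avoiding_trees S \<times> avoiders (A - S) \<rho>)"
    by (rule image_eqI[OF _ mem]) (subst prod.case, subst prod.case, subst prod.case, rule eq)
qed

text \<open>
  For \<open>Suc k = n\<close> the subtracted \<open>1\<close> really comes off: deleting the root of the forbidden tree leaves
  a forest that is too small to contain a pendant copy, so the forbidden tree is among those counted
  by \<open>Suc k * avoider_bound n k\<close>.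
\<close>

lemma card_avoiding_trees:
  assumes "finite S" "card S = Suc k"
    and IH: "\<And>r. r \<in> S \<Longrightarrow> card (avoiders (S - {r}) r) \<le> avoider_bound n k"
  shows "card (avoiding_trees S) \<le> Suc k * avoider_bound n k - (if Suc k = n then 1 else 0)"
proof -
  let ?X = "SIGMA r:S. avoiders (S - {r}) r"
  have "card ?X = (\<Sum>r\<in>S. card (avoiders (S - {r}) r))"
    using assms by (intro card_SigmaI) (auto intro: finite_avoiders)
  also have "\<dots> \<le> (\<Sum>r\<in>S. avoider_bound n k)" using IH by (rule sum_mono)
  finally have X: "card ?X \<le> Suc k * avoider_bound n k" using assms by simp
  show ?thesis
  proof (cases "Suc k = n")
    case True
    have "card C < n" if "C \<subseteq> S - {p S}" for C
      using that assms True root_in[of S] card_mono[of "S - {p S}" C] by auto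
    then have "\<not> pendant_copy (S - {p S}) (h S) C" for C
      unfolding pendant_copy_def by (metis less_irrefl)
    then have "h S \<in> avoiders (S - {p S}) (p S)"
      using parent_forest[of S] assms True by (simp add: avoiders_def)
    then have "(p S, h S) \<in> ?X" using root_in[of S] assms True by auto
    then show ?thesis
      using X True assms(2) by (simp add: avoiding_trees_def)
  qed (use X assms in \<open>simp add: avoiding_trees_def\<close>)
qed

lemma card_avoiders_le:
  assumes "finite A" "\<rho> \<notin> A"
  shows "card (avoiders A \<rho>) \<le> avoider_bound n (card A)"
  using assms
proof (induction "card A" arbitrary: A \<rho> rule: less_induct)
  case less
  show ?case
  proof (cases "A = {}")
    case True
    have "avoiders {} \<rho> \<subseteq> {\<lambda>_. undefined}" by (auto simp: avoiders_def)
    then show ?thesis using True card_mono[of "{\<lambda>_. undefined}" "avoiders {} \<rho>"] by simp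
  next
    case False
    then obtain a where a: "a \<in> A" by blast
    obtain b where b: "card A = Suc b" using less.prems a by (cases "card A") auto
    define N where "N = avoider_bound n"
    define g where "g k = (Suc k * N k - (if Suc k = n then 1 else 0)) * N (b - k)" for k
    let ?\<S> = "{S\<in>Pow A. a \<in> S}"
    let ?X = "SIGMA S:?\<S>. avoiding_trees S \<times> avoiders (A - S) \<rho>"
    have finS: "finite S" if "S \<in> ?\<S>" for S using that less.prems finite_subset by auto
    have fin: "finite (avoiding_trees S \<times> avoiders (A - S) \<rho>)" if "S \<in> ?\<S>" for S
      using finS[OF that] less.prems
      by (intro finite_cartesian_product finite_avoiding_trees finite_avoiders finite_Diff)
    have fin\<S>: "finite ?\<S>" using less.prems(1) by simp
    then have "finite ?X" using fin by (rule finite_SigmaI)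
    then have "card (avoiders A \<rho>) \<le> card ?X"
      using avoiders_decomposition[OF less.prems a] by (rule surj_card_le)
    also have "\<dots> = (\<Sum>S\<in>?\<S>. card (avoiding_trees S) * card (avoiders (A - S) \<rho>))"
      using fin\<S> fin by (subst card_SigmaI) (simp_all add: card_cartesian_product)
    also have "\<dots> \<le> (\<Sum>S\<in>?\<S>. g (card S - 1))"
    proof (intro sum_mono)
      fix S assume S: "S \<in> ?\<S>"
      then obtain k where k: "card S = Suc k" using finS[OF S] by (cases "card S") auto
      have le: "card S \<le> card A" using S less.prems by (auto intro: card_mono)
      have "card (avoiders (S - {r}) r) \<le> N k" if "r \<in> S" for r
        using less.hyps[of "S - {r}" r] finS[OF S] that k le by (simp add: N_def)
      then have "card (avoiding_trees S) \<le> Suc k * N k - (if Suc k = n then 1 else 0)"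
        using card_avoiding_trees[OF finS[OF S] k] by (simp add: N_def)
      moreover have "card (A - S) = b - k" using S finS[OF S] k b by (simp add: card_Diff_subset)
      then have "card (avoiders (A - S) \<rho>) \<le> N (b - k)"
        using less.hyps[of "A - S" \<rho>] less.prems b by (simp add: N_def)
      ultimately show "card (avoiding_trees S) * card (avoiders (A - S) \<rho>) \<le> g (card S - 1)"
        unfolding g_def k diff_Suc_1 by (rule mult_le_mono)
    qed
    also have "\<dots> = (\<Sum>S\<in>Pow (A - {a}). g (card S))"
    proof (rule sum.reindex_bij_witness[of _ "insert a" "\<lambda>S. S - {a}"])
      fix S assume "S \<in> ?\<S>"
      then show "g (card (S - {a})) = g (card S - 1)" using finS by (simp add: card_Diff_singleton)
    qed (use a in auto)
    also have "\<dots> = (\<Sum>k\<le>b. (b choose k) * g k)"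
      using sum_Pow_card[of "A - {a}" g] less.prems a b by simp
    also have "\<dots> = avoider_bound n (card A)" by (simp add: b g_def N_def mult.assoc)
    finally show ?thesis .
  qed
qed

end

section \<open>Exponential growth rate of avoiding forests\<close>

text \<open>
  The hypothesis says that \<open>\<Phi>(y) = \<Sum> \<phi> a y\<^sup>a\<close> and \<open>P(y) = \<Sum> \<tau> s y\<^sup>s\<close> satisfy \<open>\<Phi>' = P' \<Phi>\<close> as formal
  series, that is \<open>\<Phi> = exp P\<close>. For the truncations only \<open>\<Phi>' \<le> P' \<Phi>\<close> on \<open>[0, 1]\<close> survives, because all
  coefficients are nonnegative; this makes \<open>\<Phi> exp (- P)\<close> nonincreasing.
\<close>

lemma sum_le_exp_sum:
  fixes \<phi> \<tau> :: "nat \<Rightarrow> real"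
  assumes \<phi>: "\<And>a. \<phi> a \<ge> 0" "\<phi> 0 = 1" and \<tau>: "\<And>s. \<tau> (Suc s) \<ge> 0"
    and rec: "\<And>a. real (Suc a) * \<phi> (Suc a) = (\<Sum>k\<le>a. real (Suc k) * \<tau> (Suc k) * \<phi> (a - k))"
  shows "(\<Sum>a\<le>M. \<phi> a) \<le> exp (\<Sum>s<M. \<tau> (Suc s))"
proof -
  define P where "P y = (\<Sum>s<M. \<tau> (Suc s) * y ^ Suc s)" for y
  define P' where "P' y = (\<Sum>s<M. real (Suc s) * \<tau> (Suc s) * y ^ s)" for y
  define \<Phi> where "\<Phi> y = (\<Sum>a\<le>M. \<phi> a * y ^ a)" for y
  define \<Phi>' where "\<Phi>' y = (\<Sum>a<M. real (Suc a) * \<phi> (Suc a) * y ^ a)" for y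
  have dP: "(P has_real_derivative P' y) (at y)" for y
    unfolding P_def P'_def by (auto intro!: derivative_eq_intros sum.cong simp del: power_Suc of_nat_Suc)
  have "\<Phi> = (\<lambda>y. \<phi> 0 + (\<Sum>a<M. \<phi> (Suc a) * y ^ Suc a))"
    by (simp add: \<Phi>_def fun_eq_iff sum.atMost_shift)
  then have d\<Phi>: "(\<Phi> has_real_derivative \<Phi>' y) (at y)" for y
    unfolding \<Phi>'_def by (auto intro!: derivative_eq_intros sum.cong simp del: power_Suc of_nat_Suc)
  have le: "\<Phi>' y \<le> P' y * \<Phi> y" if "y \<ge> 0" for y
  proof -
    let ?t = "\<lambda>(k, j). (real (Suc k) * \<tau> (Suc k) * y ^ k) * (\<phi> j * y ^ j)"
    have "\<Phi>' y = (\<Sum>a<M. \<Sum>k\<le>a. ?t (k, a - k))"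
      unfolding \<Phi>'_def rec
    proof (intro sum.cong refl)
      fix a
      have "y ^ a = y ^ k * y ^ (a - k)" if "k \<le> a" for k using that by (simp flip: power_add)
      then show "(\<Sum>k\<le>a. real (Suc k) * \<tau> (Suc k) * \<phi> (a - k)) * y ^ a = (\<Sum>k\<le>a. ?t (k, a - k))"
        unfolding sum_distrib_right by (intro sum.cong refl) auto
    qed
    also have "\<dots> = (\<Sum>(k, j)\<in>{(k, j). k + j < M}. ?t (k, j))"
      using sum.triangle_reindex[of "\<lambda>k j. ?t (k, j)" M] by simp
    also have "\<dots> \<le> (\<Sum>(k, j)\<in>{..<M} \<times> {..M}. ?t (k, j))"
      using that \<phi> \<tau> by (intro sum_mono2) auto
    also have "\<dots> = P' y * \<Phi> y"
      by (simp add: P'_def \<Phi>_def sum_product sum.cartesian_product)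
    finally show ?thesis .
  qed
  have "\<Phi> 1 * exp (- P 1) \<le> \<Phi> 0 * exp (- P 0)"
  proof (rule DERIV_nonpos_imp_nonincreasing[of 0 1 "\<lambda>y. \<Phi> y * exp (- P y)"])
    fix y :: real assume "0 \<le> y" "y \<le> 1"
    have "((\<lambda>y. \<Phi> y * exp (- P y)) has_real_derivative (\<Phi>' y - P' y * \<Phi> y) * exp (- P y)) (at y)"
      by (auto intro!: derivative_eq_intros dP d\<Phi> simp: algebra_simps)
    moreover have "(\<Phi>' y - P' y * \<Phi> y) * exp (- P y) \<le> 0"
      using le[OF \<open>0 \<le> y\<close>] by (simp add: mult_nonpos_nonneg)
    ultimately show "\<exists>d. ((\<lambda>y. \<Phi> y * exp (- P y)) has_real_derivative d) (at y) \<and> d \<le> 0" by blast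
  qed simp
  moreover have "\<Phi> 0 = 1" "P 0 = 0" by (simp_all add: \<Phi>_def P_def \<phi> zero_power sum.atMost_shift)
  ultimately have "\<Phi> 1 \<le> exp (P 1)" by (simp add: exp_minus field_simps)
  then show ?thesis by (simp add: \<Phi>_def P_def)
qed

text \<open>
  Below \<open>n\<close> nothing is forbidden. Hence the truncated subtraction in the recurrence is a true one.
\<close>

lemma avoider_bound_pos: "k < n \<Longrightarrow> 0 < avoider_bound n k"
proof (induction k)
  case (Suc a)
  have "0 < (a choose 0) * (Suc 0 * avoider_bound n 0 - (if Suc 0 = n then 1 else 0)) * avoider_bound n (a - 0)"
    using Suc by simp
  then show ?case
    unfolding avoider_bound.simps by (intro sum_pos2[of _ 0]) auto
qed simp

text \<open>
  With \<open>\<phi> x a\<close> and \<open>\<tau> x s\<close> the terms of the generating functions of avoiding forests and avoiding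
  trees, the partial sums \<open>\<sigma>\<close> of \<open>\<tau>\<close> satisfy \<open>\<sigma> x (M + 1) \<le> x exp (\<sigma> x M)\<close>, with \<open>x\<^sup>n / n!\<close> subtracted on
  the right once \<open>M + 1 \<ge> n\<close>. Thus \<open>\<sigma> x M \<le> 1\<close> propagates from \<open>M\<close> to \<open>M + 1\<close> as soon as
  \<open>x e - x\<^sup>n / n! \<le> 1\<close>, provided that it holds for \<open>M < n\<close>. At \<open>x = 1/e\<close> both conditions hold
  strictly, hence also for some larger \<open>x\<close>.
\<close>

lemma avoider_bound_growth:
  assumes n: "n \<ge> 1"
  shows "\<exists>x. x > exp (- 1) \<and> (\<forall>a. real (avoider_bound n a) * x ^ a / fact a \<le> exp 1)"
proof -
  define t where "t k = Suc k * avoider_bound n k - (if Suc k = n then 1 else 0)" for k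
  define \<phi> where "\<phi> x a = real (avoider_bound n a) * x ^ a / fact a" for x :: real and a
  define \<tau> where "\<tau> x s = real (t (s - 1)) * x ^ s / fact s" for x :: real and s
  define \<sigma> where "\<sigma> x M = (\<Sum>s<M. \<tau> x (Suc s))" for x M
  have t: "real (t k) = real (Suc k) * real (avoider_bound n k) - (if Suc k = n then 1 else 0)" for k
    using avoider_bound_pos[of k n] by (simp add: t_def of_nat_diff Suc_le_eq algebra_simps)
  have pos: "\<phi> x a \<ge> 0" "\<tau> x a \<ge> 0" if "x \<ge> 0" for x a
    using that by (simp_all add: \<phi>_def \<tau>_def)
  have rec: "real (Suc a) * \<phi> x (Suc a) = (\<Sum>k\<le>a. real (Suc k) * \<tau> x (Suc k) * \<phi> x (a - k))" for x a
  proof -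
    have "real (Suc a) * \<phi> x (Suc a) = real (avoider_bound n (Suc a)) * x ^ Suc a / fact a"
      by (simp add: \<phi>_def fact_Suc del: avoider_bound.simps power_Suc of_nat_Suc)
    also have "\<dots> = (\<Sum>k\<le>a. real (a choose k) * real (t k) * real (avoider_bound n (a - k)) * x ^ Suc a / fact a)"
      by (simp add: t_def sum_distrib_right sum_divide_distrib del: power_Suc of_nat_Suc mult_Suc)
    also have "\<dots> = (\<Sum>k\<le>a. real (Suc k) * \<tau> x (Suc k) * \<phi> x (a - k))"
    proof (intro sum.cong refl)
      fix k assume "k \<in> {..a}"
      then have k: "k \<le> a" by simp
      have "real (a choose k) = fact a / (fact k * fact (a - k))" using k by (rule binomial_fact)
      moreover have "x ^ Suc a = x ^ Suc k * x ^ (a - k)" using k by (simp flip: power_add)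
      moreover have "real (Suc k) * \<tau> x (Suc k) = real (t k) * x ^ Suc k / fact k"
        by (simp add: \<tau>_def fact_Suc del: of_nat_Suc power_Suc)
      ultimately show "real (a choose k) * real (t k) * real (avoider_bound n (a - k)) * x ^ Suc a / fact a
          = real (Suc k) * \<tau> x (Suc k) * \<phi> x (a - k)"
        unfolding \<phi>_def by (simp del: power_Suc)
    qed
    finally show ?thesis .
  qed
  have exp_bound: "(\<Sum>a\<le>M. \<phi> x a) \<le> exp (\<sigma> x M)" if "x \<ge> 0" for x M
    unfolding \<sigma>_def by (rule sum_le_exp_sum) (use pos[OF that] rec in \<open>auto simp: \<phi>_def\<close>)
  have \<tau>_Suc: "\<tau> x (Suc k) = x * \<phi> x k - (if Suc k = n then x ^ n / fact n else 0)" for x k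
  proof -
    have "\<tau> x (Suc k) = real (Suc k) * real (avoider_bound n k) * x ^ Suc k / fact (Suc k)
        - (if Suc k = n then 1 else 0) * x ^ Suc k / fact (Suc k)"
      unfolding \<tau>_def diff_Suc_1 t by (simp only: left_diff_distrib diff_divide_distrib)
    also have "real (Suc k) * real (avoider_bound n k) * x ^ Suc k / fact (Suc k) = x * \<phi> x k"
      by (simp add: \<phi>_def fact_Suc del: of_nat_Suc)
    finally show ?thesis by (auto simp del: of_nat_Suc power_Suc fact_Suc)
  qed
  have \<sigma>_Suc: "\<sigma> x (Suc M) = x * (\<Sum>a\<le>M. \<phi> x a) - (if n \<le> Suc M then x ^ n / fact n else 0)" for x M
  proof -
    have "(\<Sum>k\<le>M. if Suc k = n then x ^ n / fact n else 0) = (\<Sum>k\<le>M. if n - 1 = k then x ^ n / fact n else 0)"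
      using n by (intro sum.cong) auto
    then have "(\<Sum>k\<le>M. if Suc k = n then x ^ n / fact n else 0) = (if n \<le> Suc M then x ^ n / fact n else 0)"
      using n by (auto simp: sum.delta)
    then show ?thesis
      by (simp add: \<sigma>_def lessThan_Suc_atMost \<tau>_Suc sum_subtractf sum_distrib_left)
  qed
  have \<sigma>_mono: "\<sigma> x M \<le> \<sigma> x M'" if "x \<ge> 0" "M \<le> M'" for x M M'
    unfolding \<sigma>_def using that pos[OF that(1)] by (intro sum_mono2) auto
  let ?y = "exp (- 1) :: real"
  have y: "?y * exp 1 = 1" by (simp flip: exp_add)
  have \<sigma>_y: "\<sigma> ?y M \<le> 1" for M
  proof (induction M)
    case (Suc M)
    have "\<sigma> ?y (Suc M) \<le> ?y * exp (\<sigma> ?y M)"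
    proof -
      have "?y * (\<Sum>a\<le>M. \<phi> ?y a) \<le> ?y * exp (\<sigma> ?y M)" using exp_bound[of ?y M] by simp
      moreover have "0 \<le> (if n \<le> Suc M then ?y ^ n / fact n else 0)" by simp
      ultimately show ?thesis using \<sigma>_Suc[of ?y M] by linarith
    qed
    also have "\<dots> \<le> ?y * exp 1" using Suc by simp
    finally show ?case using y by simp
  qed (simp add: \<sigma>_def)
  \<comment> \<open>Strictness for \<open>M < n\<close> comes from the subtraction at index \<open>n\<close>: the sum up to there is at most \<open>1 - ?y ^ n / fact n\<close>, and partial sums increase.\<close>
  have "\<sigma> ?y (n - 1) \<le> \<sigma> ?y (Suc (n - 1))" by (rule \<sigma>_mono) auto
  also have "\<dots> = ?y * (\<Sum>a\<le>n - 1. \<phi> ?y a) - ?y ^ n / fact n" using n \<sigma>_Suc[of ?y "n - 1"] by simp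
  also have "?y * (\<Sum>a\<le>n - 1. \<phi> ?y a) \<le> ?y * exp (\<sigma> ?y (n - 1))" using exp_bound[of ?y] by simp
  also have "\<dots> \<le> ?y * exp 1" using \<sigma>_y by simp
  finally have "\<sigma> ?y (n - 1) \<le> ?y * exp 1 - ?y ^ n / fact n" by simp
  moreover have y2: "?y * exp 1 - ?y ^ n / fact n < 1" unfolding y by simp
  ultimately have *: "\<sigma> ?y (n - 1) < 1" by linarith
  have "continuous_on UNIV (\<lambda>x. \<sigma> x (n - 1))"
    unfolding \<sigma>_def \<tau>_def by (intro continuous_intros) auto
  then have "((\<lambda>x. \<sigma> x (n - 1)) \<longlongrightarrow> \<sigma> ?y (n - 1)) (at ?y)" by (simp add: continuous_on_def)
  then have ev1: "\<forall>\<^sub>F x in at ?y. \<sigma> x (n - 1) < 1" using * by (rule order_tendstoD)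
  have "((\<lambda>x::real. x * exp 1 - x ^ n / fact n) \<longlongrightarrow> ?y * exp 1 - ?y ^ n / fact n) (at ?y)"
    by (intro tendsto_intros) auto
  then have ev2: "\<forall>\<^sub>F x in at ?y. x * exp 1 - x ^ n / fact n < 1"
    using y2 by (rule order_tendstoD)
  have "\<forall>\<^sub>F x in at_right ?y. \<sigma> x (n - 1) < 1 \<and> x * exp 1 - x ^ n / fact n < 1 \<and> x > ?y"
    using ev1 ev2 unfolding eventually_at_split
    by (auto intro!: eventually_conj simp: eventually_at_right_less)
  then obtain x where x: "\<sigma> x (n - 1) < 1" "x * exp 1 - x ^ n / fact n < 1" "x > ?y"
    by (auto dest!: eventually_happens simp: trivial_limit_at_right_real)
  have x0: "x \<ge> 0" using x(3) by (metis exp_ge_zero less_imp_le order_trans)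
  have \<sigma>_x: "\<sigma> x M \<le> 1" for M
  proof (induction M)
    case (Suc M)
    show ?case
    proof (cases "n \<le> Suc M")
      case True
      have "x * (\<Sum>a\<le>M. \<phi> x a) \<le> x * exp 1"
        using exp_bound[OF x0, of M] Suc x0 by (intro mult_left_mono) (auto intro: order_trans)
      then show ?thesis using True x(2) by (simp add: \<sigma>_Suc)
    next
      case False
      then have "\<sigma> x (Suc M) \<le> \<sigma> x (n - 1)" using x0 by (intro \<sigma>_mono) auto
      then show ?thesis using x(1) by simp
    qed
  qed (simp add: \<sigma>_def)
  have "\<phi> x a \<le> exp 1" for a
  proof -
    have "\<phi> x a \<le> (\<Sum>b\<le>a. \<phi> x b)" using pos[OF x0] by (intro member_le_sum) auto
    also have "\<dots> \<le> exp (\<sigma> x a)" by (rule exp_bound[OF x0])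
    also have "\<dots> \<le> exp 1" using \<sigma>_x by simp
    finally show ?thesis .
  qed
  then show ?thesis using x(3) unfolding \<phi>_def by blast
qed

text \<open>
  The induction step is \<open>e \<le> (1 + 1/m) ^ (m + 1)\<close>, which follows from \<open>1 + t \<le> exp t\<close> at
  \<open>t = - 1 / (m + 1)\<close>.
\<close>

lemma fact_le_Stirling:
  assumes "m \<ge> 1"
  shows "fact m \<le> exp 1 * real m * real m ^ m * exp (- real m)"
  using assms
proof (induction m rule: nat_induct_at_least)
  case base
  show ?case by (simp flip: exp_add)
next
  case (Suc m)
  have "exp 1 * real m ^ Suc m \<le> real (Suc m) ^ Suc m"
  proof -
    have "real m / real (Suc m) \<le> exp (- 1 / real (Suc m))"
      using exp_ge_add_one_self[of "- 1 / real (Suc m)"] by (simp add: field_simps)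
    then have "(real m / real (Suc m)) ^ Suc m \<le> exp (- 1 / real (Suc m)) ^ Suc m"
      by (intro power_mono) auto
    also have "\<dots> = exp (- 1)" by (simp flip: exp_of_nat_mult del: of_nat_Suc power_Suc)
    finally show ?thesis
      by (simp add: power_divide exp_minus field_simps del: power_Suc of_nat_Suc)
  qed
  then have **: "real m ^ Suc m \<le> real (Suc m) ^ Suc m * exp (- 1)"
    by (simp add: exp_minus field_simps del: power_Suc of_nat_Suc)
  have "fact (Suc m) \<le> real (Suc m) * (exp 1 * real m * real m ^ m * exp (- real m))"
    using Suc.IH by (simp add: mult_left_mono del: of_nat_Suc)
  also have "\<dots> = exp 1 * real (Suc m) * real m ^ Suc m * exp (- real m)" by simp
  also have "\<dots> \<le> exp 1 * real (Suc m) * (real (Suc m) ^ Suc m * exp (- 1)) * exp (- real m)"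
    using ** by (intro mult_left_mono mult_right_mono) auto
  also have "\<dots> = exp 1 * real (Suc m) * real (Suc m) ^ Suc m * exp (- real (Suc m))"
    by (simp add: exp_diff exp_minus field_simps)
  finally show ?case .
qed

section \<open>Trees as graphs of parent functions\<close>

definition parent_graph :: "'a set \<Rightarrow> 'a \<Rightarrow> ('a \<Rightarrow> 'a) \<Rightarrow> 'a pair_pre_digraph" where
  "parent_graph A \<rho> f = \<lparr>pverts = insert \<rho> A,
     parcs = {(x, f x) | x. x \<in> A} \<union> {(f x, x) | x. x \<in> A}\<rparr>"

text \<open>
  Reduces connectedness, which is defined by an auxiliary symmetrised digraph and by walks within a
  vertex set, to the reflexive transitive closure of the arc relation.
\<close>

lemma connected_sym_iff:
  fixes G :: "('a, 'a \<times> 'a) pre_digraph"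
  assumes G: "wf_digraph G" "tail G = fst" "head G = snd" and sym: "sym (arcs G)"
  shows "Digraph_Component.connected G \<longleftrightarrow>
    verts G \<noteq> {} \<and> (\<forall>u\<in>verts G. \<forall>v\<in>verts G. (u, v) \<in> (arcs G)\<^sup>*)"
proof -
  interpret wf_digraph G by fact
  have "arcs_ends G = arcs G" using G by (auto simp: arcs_ends_def arc_to_ends_def)
  moreover have "arcs_ends (mk_symmetric G) = arcs G"
    using sym G by (fastforce simp: mk_symmetric_def sym_def)
  moreover have "wf_digraph (mk_symmetric G)"
    using G by (auto simp: mk_symmetric_def wf_digraph_def)
  then interpret S: wf_digraph "mk_symmetric G" .
  show ?thesis
    unfolding Digraph_Component.connected_def strongly_connected_def
    using calculation S.reachable_conv' by (auto simp: mk_symmetric_def)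
qed

lemma rtrancl_through_root:
  assumes "sym R" "\<And>x. x \<in> V \<Longrightarrow> (x, r) \<in> R\<^sup>*" "u \<in> V" "v \<in> V"
  shows "(u, v) \<in> R\<^sup>*"
  using assms by (meson rtrancl_trans sym_rtrancl symD)

text \<open>
  The successor and the predecessor of \<open>x\<close> along the cycle; they differ since there are at least
  three vertices.
\<close>

lemma cycle_two_neighbours:
  assumes G: "pair_wf_digraph G" and c: "pre_digraph.cycle (with_proj G) c" "3 \<le> length c"
    and sym: "sym (parcs G)" and x: "x \<in> snd ` set c"
  obtains y z where "y \<in> snd ` set c" "z \<in> snd ` set c" "y \<noteq> z" "(x, y) \<in> parcs G" "(x, z) \<in> parcs G"
proof -
  interpret pair_wf_digraph G by fact
  obtain u where u: "awalk u c u" "distinct (tl (awalk_verts u c))" "c \<noteq> []"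
    using c by (auto simp: cycle_def)
  have cas: "cas u c u" and arcs: "set c \<subseteq> parcs G" using u(1) by (auto simp: awalk_def)
  have dist: "distinct (map snd c)" using u cas awalk_verts_conv'[OF cas] by simp
  have "cas w c v \<Longrightarrow> Suc i < length c \<Longrightarrow> fst (c ! Suc i) = snd (c ! i)" for w v i
  proof (induction c arbitrary: w i)
    case (Cons e es)
    show ?case
    proof (cases i)
      case 0
      then show ?thesis using Cons.prems by (cases es) auto
    next
      case (Suc j)
      then show ?thesis using Cons.IH[of "snd e" j] Cons.prems by simp
    qed
  qed simp
  from this[OF cas] have step: "fst (c ! Suc i) = snd (c ! i)" if "Suc i < length c" for i
    using that by blast
  have wrap: "fst (c ! 0) = snd (c ! (length c - 1))"
  proof -
    have "fst (hd c) = u" "snd (last c) = u"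
      using cas u(3) by (cases c; simp) (use cas u(3) awlast_if_cas[OF cas] awalk_verts_conv[of u c] in simp)
    then show ?thesis using u(3) by (simp add: hd_conv_nth last_conv_nth)
  qed
  let ?k = "length c"
  obtain i where i: "i < ?k" "x = snd (c ! i)" using x by (auto simp: in_set_conv_nth)
  \<comment> \<open>With \<open>x\<close> the head of arc \<open>i\<close>, the two neighbours are the heads of the cyclically next and previous arcs \<open>j\<close> and \<open>l\<close>.\<close>
  define j where "j = (if Suc i < ?k then Suc i else 0)"
  define l where "l = (if i = 0 then ?k - 1 else i - 1)"
  have lt: "j < ?k" "l < ?k" "j \<noteq> l" using i c(2) by (auto simp: j_def l_def)
  have fj: "fst (c ! j) = x"
  proof (cases "Suc i < ?k")
    case True
    then show ?thesis using step[OF True] i by (simp add: j_def)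
  next
    case False
    then have "i = ?k - 1" using i by simp
    then show ?thesis using wrap i(2) False by (simp add: j_def)
  qed
  have fl: "fst (c ! i) = snd (c ! l)"
  proof (cases i)
    case (Suc i')
    then show ?thesis using step[of i'] i by (simp add: l_def)
  qed (use wrap in \<open>simp add: l_def\<close>)
  show thesis
  proof (rule that[of "snd (c ! j)" "snd (c ! l)"])
    show "snd (c ! j) \<noteq> snd (c ! l)"
      using dist lt by (metis length_map nth_eq_iff_index_eq nth_map)
    have "c ! j \<in> parcs G" "c ! i \<in> parcs G" using arcs lt i nth_mem by blast+
    then show "(x, snd (c ! j)) \<in> parcs G" "(x, snd (c ! l)) \<in> parcs G"
      using fj fl i sym by (metis prod.collapse, metis prod.collapse symD)
  qed (use lt in auto)
qed

lemma pair_graph_parent_graph: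
  assumes f: "f \<in> forests A {\<rho>}" and fin: "finite A" and \<rho>: "\<rho> \<notin> A"
  shows "pair_graph (parent_graph A \<rho> f)"
proof -
  have maps: "f x \<in> insert \<rho> A" if "x \<in> A" for x using f that by (auto simp: forests_def)
  have noloop: "f x \<noteq> x" if "x \<in> A" for x
    using f that acyclic_onE[of A f "{x}"] by (auto simp: forests_def)
  have "parcs (parent_graph A \<rho> f) = (\<lambda>x. (x, f x)) ` A \<union> (\<lambda>x. (f x, x)) ` A"
    by (auto simp: parent_graph_def)
  then have "finite (parcs (parent_graph A \<rho> f))" using fin by simp
  then show ?thesis
    using maps noloop fin
    by unfold_locales
      (auto simp: parent_graph_def symmetric_def arcs_ends_def arc_to_ends_def with_proj_def sym_def
         dest: noloop[symmetric] maps)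
qed

lemma sym_parent_graph: "sym (parcs (parent_graph A \<rho> f))"
  by (auto simp: parent_graph_def sym_def)

text \<open>
  Stated for a set \<open>C\<close> closed under parents up to the root, because connectedness is needed both for
  the whole tree and for a single fiber.
\<close>

lemma forest_reaches_root:
  assumes f: "f \<in> forests A {\<rho>}" and x: "x \<in> C" and C: "C \<subseteq> A"
    and cl: "\<And>x. x \<in> C \<Longrightarrow> f x \<in> insert \<rho> C"
  shows "(x, \<rho>) \<in> {(x, f x) | x. x \<in> C}\<^sup>*"
proof -
  let ?E = "{(x, f x) | x. x \<in> C}"
  let ?X = "{y\<in>C. (x, y) \<in> ?E\<^sup>*}"
  have "acyclic_on A f" using f by (simp add: forests_def)
  then obtain y where y: "y \<in> ?X" "f y \<notin> ?X" by (rule acyclic_onE[of A f ?X]) (use x C in auto)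
  then have "(x, f y) \<in> ?E\<^sup>*" by (auto intro: rtrancl_into_rtrancl)
  then show ?thesis using y cl by blast
qed

text \<open>
  On a cycle every vertex has two neighbours and at most one of them is its parent, so every vertex
  is the parent of another vertex of the cycle. By counting, \<open>f\<close> then permutes the vertices of the cycle,
  contrary to acyclicity.
\<close>

lemma undirected_tree_parent_graph:
  assumes f: "f \<in> forests A {\<rho>}" and fin: "finite A" and \<rho>: "\<rho> \<notin> A"
  shows "undirected_tree (parent_graph A \<rho> f)"
proof -
  let ?G = "parent_graph A \<rho> f"
  interpret pair_graph ?G using assms by (rule pair_graph_parent_graph)
  have maps: "f x \<in> insert \<rho> A" if "x \<in> A" for x using f that by (auto simp: forests_def)
  have "(x, \<rho>) \<in> (parcs ?G)\<^sup>*" if "x \<in> pverts ?G" for x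
  proof (cases "x = \<rho>")
    case False
    then have "(x, \<rho>) \<in> {(x, f x) | x. x \<in> A}\<^sup>*"
      using that maps by (intro forest_reaches_root[OF f]) (auto simp: parent_graph_def)
    then show ?thesis by (rule rtrancl_mono[THEN subsetD, rotated]) (auto simp: parent_graph_def)
  qed simp
  then have "\<forall>u\<in>pverts ?G. \<forall>v\<in>pverts ?G. (u, v) \<in> (parcs ?G)\<^sup>*"
    by (meson rtrancl_through_root[OF sym_parent_graph])
  moreover have "pverts ?G \<noteq> {}" by (simp add: parent_graph_def)
  ultimately have "Digraph_Component.connected (with_proj ?G)"
    using connected_sym_iff[of "with_proj ?G"] wf_digraph sym_parent_graph[of A \<rho> f] by simp
  moreover have False if c: "pre_digraph.cycle (with_proj ?G) c" "3 \<le> length c" for c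
  proof -
    let ?X = "snd ` set c"
    have child: "\<exists>y\<in>?X \<inter> A. f y = x" if x: "x \<in> ?X" for x
    proof -
      obtain y z where yz: "y \<in> ?X" "z \<in> ?X" "y \<noteq> z" "(x, y) \<in> parcs ?G" "(x, z) \<in> parcs ?G"
        using cycle_two_neighbours[OF pair_wf_digraph c sym_parent_graph x] .
      then have "(x \<in> A \<and> y = f x) \<or> (y \<in> A \<and> f y = x)" "(x \<in> A \<and> z = f x) \<or> (z \<in> A \<and> f z = x)"
        by (auto simp: parent_graph_def)
      then show ?thesis using yz by blast
    qed
    have sub: "?X \<subseteq> f ` (?X \<inter> A)"
    proof
      fix x assume "x \<in> ?X"
      from child[OF this] obtain y where "y \<in> ?X \<inter> A" "f y = x" ..
      then show "x \<in> f ` (?X \<inter> A)" by (intro image_eqI[of _ _ y]) simp_all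
    qed
    then have "card ?X \<le> card (f ` (?X \<inter> A))" by (intro card_mono) auto
    also have "\<dots> \<le> card (?X \<inter> A)" by (intro card_image_le) auto
    finally have "?X \<inter> A = ?X" by (intro card_seteq) auto
    then have XA: "?X \<subseteq> A" and "?X \<subseteq> f ` ?X" using sub by (blast, simp)
    then have "?X = f ` ?X" by (intro card_seteq card_image_le) auto
    moreover have "?X \<noteq> {}" using c(2) by auto
    moreover have "acyclic_on A f" using f by (simp add: forests_def)
    ultimately obtain x where "x \<in> ?X" "f x \<notin> ?X" using XA by (elim acyclic_onE)
    then show False using \<open>?X = f ` ?X\<close> by (metis imageI)
  qed
  ultimately show ?thesis using pair_graph by (auto simp: undirected_tree_def)
qed

text \<open>
  Among the points where two parent functions with the same graph differ, take \<open>x\<close> such that \<open>f x\<close>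
  is not such a point. The edge between \<open>x\<close> and \<open>f x\<close> must be oriented the other way by \<open>g\<close>, whence
  \<open>f (f x) = g (f x) = x\<close>, a cycle.
\<close>

lemma inj_on_parent_graph:
  assumes "\<rho> \<notin> A"
  shows "inj_on (parent_graph A \<rho>) (forests A {\<rho>})"
proof (rule inj_onI, rule ccontr)
  fix f g assume f: "f \<in> forests A {\<rho>}" and g: "g \<in> forests A {\<rho>}"
    and eq: "parent_graph A \<rho> f = parent_graph A \<rho> g" and "f \<noteq> g"
  let ?D = "{x\<in>A. f x \<noteq> g x}"
  have "f x = g x" if "x \<notin> A" for x using f g that by (auto simp: forests_def PiE_def extensional_def)
  then have "?D \<noteq> {}" using \<open>f \<noteq> g\<close> by (force simp: fun_eq_iff)
  then obtain x where x: "x \<in> ?D" "f x \<notin> ?D"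
    using f acyclic_onE[of A f ?D] by (auto simp: forests_def)
  have "(x, f x) \<in> parcs (parent_graph A \<rho> f)" using x by (auto simp: parent_graph_def)
  then have "(x, f x) \<in> parcs (parent_graph A \<rho> g)" by (simp only: eq)
  then have y: "f x \<in> A" "g (f x) = x" using x by (auto simp: parent_graph_def)
  then have "f (f x) = x" using x by auto
  moreover obtain z where "z \<in> {x, f x}" "f z \<notin> {x, f x}"
    using f acyclic_onE[of A f "{x, f x}"] x y by (auto simp: forests_def)
  ultimately show False by auto
qed

text \<open>
  The parent of \<open>x\<close> is a neighbour closer to \<open>\<rho>\<close>. The resulting graph is a spanning tree of \<open>T\<close>, and any
  further arc of \<open>T\<close> would close a cycle with the path that joins its ends in the spanning tree.
\<close>

lemma undirected_tree_is_parent_graph: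
  assumes T: "undirected_tree T" and \<rho>: "\<rho> \<in> pverts T"
  obtains f where "f \<in> forests (pverts T - {\<rho>}) {\<rho>}" "T = parent_graph (pverts T - {\<rho>}) \<rho> f"
proof -
  let ?A = "pverts T - {\<rho>}"
  interpret pair_graph T using T by (simp add: undirected_tree_def)
  have sym: "sym (parcs T)" by (auto simp: sym_def arcs_symmetric)
  have conn: "(x, y) \<in> (parcs T)\<^sup>*" if "x \<in> pverts T" "y \<in> pverts T" for x y
    using T sym that connected_sym_iff[of "with_proj T"] wf_digraph by (auto simp: undirected_tree_def)
  define d where "d x = (LEAST k. (x, \<rho>) \<in> parcs T ^^ k)" for x
  define f where "f = restrict (\<lambda>x. SOME y. (x, y) \<in> parcs T \<and> d y < d x) ?A"
  have f: "(x, f x) \<in> parcs T \<and> d (f x) < d x" if x: "x \<in> ?A" for x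
  proof -
    have "\<exists>k. (x, \<rho>) \<in> parcs T ^^ k" using conn[of x \<rho>] x \<rho> by (auto simp: rtrancl_power)
    then have dx: "(x, \<rho>) \<in> parcs T ^^ d x" unfolding d_def by (rule LeastI_ex)
    then obtain k where k: "d x = Suc k" using x by (cases "d x") auto
    then obtain y where y: "(x, y) \<in> parcs T" "(y, \<rho>) \<in> parcs T ^^ k"
      using dx by (metis relpow_Suc_D2)
    then have "d y < d x" unfolding k d_def[of y] by (simp add: Least_le le_imp_less_Suc)
    then have "\<exists>y. (x, y) \<in> parcs T \<and> d y < d x" using y by blast
    then show ?thesis using x someI_ex[of "\<lambda>y. (x, y) \<in> parcs T \<and> d y < d x"] by (simp add: f_def)
  qed
  have "acyclic_on ?A f"
    unfolding acyclic_on_def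
  proof (intro allI impI)
    fix X assume X: "X \<subseteq> ?A" "X \<noteq> {}"
    then obtain x where "x \<in> X" "\<And>y. y \<in> X \<Longrightarrow> d x \<le> d y"
      using arg_min_nat_lemma[of "\<lambda>x. x \<in> X" _ d] by blast
    then show "\<exists>x\<in>X. f x \<notin> X" using f X by (meson leD subsetD)
  qed
  moreover have "f \<in> ?A \<rightarrow>\<^sub>E ?A \<union> {\<rho>}"
  proof (rule PiE_I)
    fix x assume "x \<in> ?A"
    then show "f x \<in> ?A \<union> {\<rho>}" using f in_arcsD2 by blast
  qed (auto simp: f_def)
  ultimately have forest: "f \<in> forests ?A {\<rho>}" by (simp add: forests_def)
  let ?P = "parent_graph ?A \<rho> f"
  have verts: "pverts ?P = pverts T" using \<rho> by (auto simp: parent_graph_def)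
  have sub: "parcs ?P \<subseteq> parcs T" using f by (auto simp: parent_graph_def intro: arcs_symmetric)
  have "parcs T \<subseteq> parcs ?P"
  proof (rule subrelI, rule ccontr)
    fix x y assume xy: "(x, y) \<in> parcs T" "(x, y) \<notin> parcs ?P"
    interpret P: pair_graph ?P using forest pair_finite_verts by (intro pair_graph_parent_graph) auto
    have "Digraph_Component.connected (with_proj ?P)"
      using undirected_tree_parent_graph[OF forest] pair_finite_verts by (simp add: undirected_tree_def)
    then have "(y, x) \<in> (parcs ?P)\<^sup>*"
      using connected_sym_iff[of "with_proj ?P"] P.wf_digraph sym_parent_graph[of ?A \<rho> f] wellformed'[OF xy(1)]
      by (simp add: verts)
    then have "reachable (with_proj ?P) y x"
      using wellformed'[OF xy(1)] by (subst P.reachable_conv') (auto simp: verts)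
    then obtain c where c: "P.apath y c x" by (auto simp: P.reachable_apath)
    have apath: "apath y c x"
      using c sub by (auto simp: apath_def P.apath_def awalk_def P.awalk_def verts)
    have "c \<noteq> []" using apath no_loops'[OF xy(1)] by (auto simp: apath_Nil_iff)
    moreover have "c \<noteq> [e]" for e
    proof
      assume e: "c = [e]"
      then have "e = (y, x)" "e \<in> parcs ?P" using c by (auto simp: P.apath_def P.awalk_def)
      then show False using xy(2) sym_parent_graph[of ?A \<rho> f] by (auto dest: symD)
    qed
    ultimately have "3 \<le> length ((x, y) # c)" by (cases c rule: remdups_adj.cases) auto
    moreover have "awalk x ((x, y) # c) x" using apath xy(1) wellformed' by (auto simp: apath_def awalk_Cons_iff)
    then have "cycle ((x, y) # c)" using apath by (auto simp: cycle_def apath_def)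
    ultimately show False using T by (auto simp: undirected_tree_def)
  qed
  then have "T = ?P" using sub verts by (intro pair_pre_digraph.equality) auto
  then show thesis using that forest by blast
qed

section \<open>A pendant copy yields a display\<close>

lemma ranked_bij:
  assumes "finite R" "card R = n"
  shows "bij_betw (ranked R) {1..n} R"
proof -
  have "bij_betw (\<lambda>i. i - 1) {1..n} {..<n}"
    by (rule bij_betw_byWitness[of _ Suc]) auto
  moreover have "bij_betw ((!) (sorted_list_of_set R)) {..<n} R"
    using assms by (intro bij_betw_nth) auto
  ultimately have "bij_betw ((!) (sorted_list_of_set R) \<circ> (\<lambda>i. i - 1)) {1..n} R"
    by (rule bij_betw_trans)
  then show ?thesis by (simp add: ranked_def[abs_def] comp_def)
qed

text \<open>
  The parent function \<open>g\<close> on \<open>{1..n}\<close>, with root \<open>n\<close>, carried over to \<open>S\<close> by the increasing bijection.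
\<close>

definition shape_parent :: "nat \<Rightarrow> (nat \<Rightarrow> nat) \<Rightarrow> nat set \<Rightarrow> nat \<Rightarrow> nat" where
  "shape_parent n g S = (\<lambda>x\<in>S - {ranked S n}. ranked S (g (inv_into {1..n} (ranked S) x)))"

lemma shape_parent_ranked:
  assumes "finite S" "card S = n" "i \<in> {1..n} - {n}"
  shows "ranked S i \<in> S - {ranked S n}" "shape_parent n g S (ranked S i) = ranked S (g i)"
proof -
  have bij: "bij_betw (ranked S) {1..n} S" using assms by (intro ranked_bij)
  have "ranked S i \<noteq> ranked S n"
    using assms(3) bij_betw_imp_inj_on[OF bij] by (subst inj_on_eq_iff) auto
  then show *: "ranked S i \<in> S - {ranked S n}" using bij assms(3) by (auto simp: bij_betw_def)
  have "inv_into {1..n} (ranked S) (ranked S i) = i"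
    using bij assms(3) by (intro inv_into_f_f) (auto simp: bij_betw_def)
  then show "shape_parent n g S (ranked S i) = ranked S (g i)" using * by (simp add: shape_parent_def)
qed

lemma ranked_cases:
  assumes "finite S" "card S = n" "x \<in> S - {ranked S n}"
  obtains i where "i \<in> {1..n} - {n}" "x = ranked S i"
proof -
  have "x \<in> ranked S ` {1..n}" using ranked_bij[OF assms(1,2)] assms(3) by (auto simp: bij_betw_def)
  then obtain i where "i \<in> {1..n}" "x = ranked S i" by blast
  then show thesis using that assms(3) by auto
qed

lemma pattern_shape:
  assumes g: "g \<in> forests ({1..n} - {n}) {n}" and n: "n \<ge> 1"
  shows "pattern n (\<lambda>S. ranked S n) (shape_parent n g)"
proof
  fix S :: "nat set" assume S: "finite S" "card S = n"
  have bij: "bij_betw (ranked S) {1..n} S" using S by (intro ranked_bij)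
  then show "ranked S n \<in> S" using n by (auto simp: bij_betw_def)
  have maps: "g i \<in> {1..n}" if "i \<in> {1..n} - {n}" for i
  proof -
    have "g i \<in> ({1..n} - {n}) \<union> {n}" using g that by (rule forests_mapsto)
    then show ?thesis using n by auto
  qed
  have "acyclic_on (S - {ranked S n}) (shape_parent n g S)"
    unfolding acyclic_on_def
  proof (intro allI impI)
    fix X assume X: "X \<subseteq> S - {ranked S n}" "X \<noteq> {}"
    let ?Y = "{i \<in> {1..n} - {n}. ranked S i \<in> X}"
    obtain x where x: "x \<in> X" using X(2) by blast
    then obtain i where "i \<in> {1..n} - {n}" "x = ranked S i"
      by (rule ranked_cases[OF S subsetD[OF X(1)]])
    then have "i \<in> ?Y" using x by simp
    then have Y: "?Y \<subseteq> {1..n} - {n}" "?Y \<noteq> {}" by (blast, metis empty_iff)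
    have "acyclic_on ({1..n} - {n}) g" using g by (simp add: forests_def)
    then obtain i where i: "i \<in> ?Y" "g i \<notin> ?Y" using Y by (rule acyclic_onE)
    then have "ranked S (g i) \<notin> X" using maps[of i] X(1) by auto
    then show "\<exists>x\<in>X. shape_parent n g S x \<notin> X"
      using i shape_parent_ranked(2)[OF S, of i g] by (intro bexI[of _ "ranked S i"]) auto
  qed
  moreover have "shape_parent n g S \<in> (S - {ranked S n}) \<rightarrow>\<^sub>E (S - {ranked S n}) \<union> {ranked S n}"
  proof (rule PiE_I)
    fix x assume "x \<in> S - {ranked S n}"
    then obtain i where i: "i \<in> {1..n} - {n}" "x = ranked S i" using ranked_cases[OF S] by blast
    then have "shape_parent n g S x = ranked S (g i)" using shape_parent_ranked(2)[OF S] by blast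
    moreover have "ranked S (g i) \<in> S" using bij maps[OF i(1)] by (auto simp: bij_betw_def)
    ultimately show "shape_parent n g S x \<in> (S - {ranked S n}) \<union> {ranked S n}" by auto
  qed (auto simp: shape_parent_def)
  ultimately show "shape_parent n g S \<in> forests (S - {ranked S n}) {ranked S n}"
    by (simp add: forests_def)
qed

text \<open>
  The retraction is the identity on \<open>S\<close> and sends everything else to the root \<open>?p\<close> of the copy. Since no
  vertex outside \<open>S\<close> has its parent in \<open>S\<close>, all paths to \<open>\<rho>\<close> that start outside \<open>S\<close> stay outside, so
  the fiber of \<open>?p\<close> is connected through \<open>\<rho>\<close>. Arcs between different fibers are exactly those inside
  \<open>S\<close>, that is, those of \<open>T\<close>.
\<close>

lemma pendant_copy_displayed:
  assumes g: "g \<in> forests ({1..n} - {n}) {n}" and n: "n \<ge> 1"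
    and f: "f \<in> forests A {\<rho>}" and fin: "finite A" and \<rho>: "\<rho> \<notin> A"
    and copy: "pattern.pendant_copy n (\<lambda>S. ranked S n) (shape_parent n g) A f S"
  shows "parent_graph ({1..n} - {n}) n g \<preceq> parent_graph A \<rho> f"
proof -
  interpret pattern n "\<lambda>S. ranked S n" "shape_parent n g" using g n by (rule pattern_shape)
  let ?U = "parent_graph A \<rho> f" and ?p = "ranked S n"
  let ?V = "insert \<rho> A"
  interpret U: pair_graph ?U using f fin \<rho> by (rule pair_graph_parent_graph)
  have S: "S \<subseteq> A" "card S = n" "f ?p \<notin> S" "\<And>x. x \<in> S - {?p} \<Longrightarrow> f x = shape_parent n g S x"
    "\<And>x. x \<in> A - S \<Longrightarrow> f x \<notin> S"
    using copy by (auto simp: pendant_copy_def)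
  have finS: "finite S" using S(1) fin by (rule finite_subset)
  have p: "?p \<in> S" using finS S(2) by (rule root_in)
  have bij: "bij_betw (ranked S) {1..n} S" using finS S(2) by (rule ranked_bij)
  have maps: "f x \<in> ?V" if "x \<in> A" for x using forests_mapsto[OF f that] by simp
  have gmaps: "g i \<in> {1..n}" if "i \<in> {1..n} - {n}" for i
  proof -
    have "g i \<in> ({1..n} - {n}) \<union> {n}" using g that by (rule forests_mapsto)
    then show ?thesis using n by auto
  qed
  define q where "q = (\<lambda>x\<in>?V. if x \<in> S then x else ?p)"
  have q: "q x = (if x \<in> S then x else ?p)" if "x \<in> ?V" for x using that by (simp add: q_def)
  have V: "pverts ?U = ?V" by (simp add: parent_graph_def)
  have fiber_single: "fiber ?U q r = {r}" if "r \<in> S - {?p}" for r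
  proof (rule set_eqI)
    fix x
    show "x \<in> fiber ?U q r \<longleftrightarrow> x \<in> {r}"
      using q[of x] that S(1) by (cases "x \<in> S") (auto simp: fiber_def V)
  qed
  have fiber_root: "fiber ?U q ?p = insert ?p (?V - S)"
  proof (rule set_eqI)
    fix x
    show "x \<in> fiber ?U q ?p \<longleftrightarrow> x \<in> insert ?p (?V - S)"
      using q[of x] p S(1) by (cases "x \<in> S") (auto simp: fiber_def V)
  qed
  have conn: "Digraph_Component.connected (with_proj ?U \<restriction> fiber ?U q r)" if r: "r \<in> S" for r
  proof -
    let ?F = "fiber ?U q r"
    let ?R = "arcs (with_proj ?U \<restriction> ?F)"
    have sym: "sym ?R" using sym_parent_graph[of A \<rho> f] by (auto simp: sym_def)
    have "\<forall>u\<in>?F. \<forall>v\<in>?F. (u, v) \<in> ?R\<^sup>*"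
    proof (cases "r = ?p")
      case True
      let ?C = "insert ?p (A - S)"
      have F: "?F = insert \<rho> ?C" using True fiber_root S(1) \<rho> by auto
      have cl: "f x \<in> insert \<rho> ?C" if "x \<in> ?C" for x
      proof -
        have "x \<in> A" "f x \<notin> S" using that p S(1,3,5) by auto
        then show ?thesis using maps[of x] by auto
      qed
      have sub: "{(x, f x) | x. x \<in> ?C} \<subseteq> ?R"
      proof
        fix e assume "e \<in> {(x, f x) | x. x \<in> ?C}"
        then obtain x where x: "e = (x, f x)" "x \<in> ?C" by blast
        then have "x \<in> A" using p S(1) by auto
        then show "e \<in> ?R" unfolding F using x cl[OF x(2)] by (simp add: parent_graph_def)
      qed
      have root: "(x, \<rho>) \<in> ?R\<^sup>*" if "x \<in> ?F" for x
      proof (cases "x = \<rho>")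
        case False
        then have "(x, \<rho>) \<in> {(x, f x) | x. x \<in> ?C}\<^sup>*"
          using that F p S(1) by (intro forest_reaches_root[OF f _ _ cl]) auto
        then show ?thesis using rtrancl_mono[OF sub] by blast
      qed simp
      show ?thesis
      proof (intro ballI)
        fix u v assume "u \<in> ?F" "v \<in> ?F"
        then show "(u, v) \<in> ?R\<^sup>*"
          by (rule rtrancl_through_root[OF sym, where V = ?F and r = \<rho>, rotated]) (rule root)
      qed
    qed (use fiber_single r in auto)
    moreover have "r \<in> ?F" using r S(1) q by (auto simp: fiber_def V)
    ultimately show ?thesis
      using connected_sym_iff[of "with_proj ?U \<restriction> ?F"] sym U.wellformed_induce_subgraph by auto
  qed
  have arc: "(x \<in> S - {?p} \<and> q x = x \<and> q (f x) = shape_parent n g S x) \<or> (q x = ?p \<and> q (f x) = ?p)"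
    if x: "x \<in> A" for x
  proof (cases "x \<in> S - {?p}")
    case True
    then obtain i where i: "i \<in> {1..n} - {n}" "x = ranked S i" using ranked_cases[OF finS S(2)] by blast
    then have "f x = ranked S (g i)" using S(4)[OF True] shape_parent_ranked(2)[OF finS S(2)] by simp
    then have "f x \<in> S" using bij gmaps[OF i(1)] by (auto simp: bij_betw_def)
    then show ?thesis using True x q[of x] q[of "f x"] maps[OF x] S(4)[OF True] by auto
  next
    case False
    then have "f x \<notin> S" using S(3,5) x by auto
    then show ?thesis using False x q[of x] q[of "f x"] maps[OF x] by auto
  qed
  have down: "j = g i \<and> i \<in> {1..n} - {n}"
    if "x \<in> A" "q x = ranked S i" "q (f x) = ranked S j" "i \<in> {1..n}" "j \<in> {1..n}" "i \<noteq> j" for x i j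
  proof -
    have inj: "ranked S i = ranked S j \<longleftrightarrow> i = j" if "i \<in> {1..n}" "j \<in> {1..n}" for i j
      using bij that by (auto simp: bij_betw_def inj_on_eq_iff)
    have "q x \<noteq> q (f x)" using inj[of i j] that by simp
    then have x: "x \<in> S - {?p}" "q x = x" "q (f x) = shape_parent n g S x" using arc[OF that(1)] by auto
    then have i: "i \<in> {1..n} - {n}" using that by auto
    then have "ranked S j = ranked S (g i)" using x that shape_parent_ranked(2)[OF finS S(2) i] by simp
    then show ?thesis using inj[of j "g i"] gmaps[OF i] that(5) i by simp
  qed
  have up: "ranked S i \<in> A \<and> q (ranked S i) = ranked S i \<and> q (f (ranked S i)) = ranked S (g i) \<and> i \<noteq> g i"
    if i: "i \<in> {1..n} - {n}" for i
  proof -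
    have r: "ranked S i \<in> S - {?p}" using shape_parent_ranked(1)[OF finS S(2) i] .
    have "f (ranked S i) = ranked S (g i)" using S(4)[OF r] shape_parent_ranked(2)[OF finS S(2) i] by simp
    moreover have "ranked S (g i) \<in> S" using bij gmaps[OF i] by (auto simp: bij_betw_def)
    moreover have "acyclic_on ({1..n} - {n}) g" using g by (simp add: forests_def)
    then obtain k where "k \<in> {i}" "g k \<notin> {i}" by (rule acyclic_onE[of _ _ "{i}"]) (use i in auto)
    then have "i \<noteq> g i" by auto
    ultimately show ?thesis using r S(1) q[of "ranked S i"] q[of "ranked S (g i)"] by auto
  qed
  have "contraction ?U S q = parent_graph ({1..n} - {n}) n g"
  proof (rule pair_pre_digraph.equality)
    show "pverts (contraction ?U S q) = pverts (parent_graph ({1..n} - {n}) n g)"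
      using n S(2) by (auto simp: contraction_def parent_graph_def)
    show "parcs (contraction ?U S q) = parcs (parent_graph ({1..n} - {n}) n g)"
    proof (intro equalityI subrelI)
      fix i j assume "(i, j) \<in> parcs (contraction ?U S q)"
      then obtain x y where ij: "i \<in> {1..n}" "j \<in> {1..n}" "i \<noteq> j" "q x = ranked S i" "q y = ranked S j"
        "(x, y) \<in> parcs ?U"
        using S(2) by (auto simp: contraction_def fiber_def)
      then have "(x \<in> A \<and> y = f x) \<or> (y \<in> A \<and> x = f y)" by (auto simp: parent_graph_def)
      then show "(i, j) \<in> parcs (parent_graph ({1..n} - {n}) n g)"
        using down[of x i j] down[of y j i] ij by (auto simp: parent_graph_def)
    next
      fix i j assume "(i, j) \<in> parcs (parent_graph ({1..n} - {n}) n g)"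
      then consider "i \<in> {1..n} - {n}" "j = g i" | "j \<in> {1..n} - {n}" "i = g j"
        by (auto simp: parent_graph_def)
      then show "(i, j) \<in> parcs (contraction ?U S q)"
      proof cases
        case 1
        then show ?thesis
          using up[OF 1(1)] gmaps[OF 1(1)] maps[of "ranked S i"] S(2)
          by (auto simp: contraction_def fiber_def V parent_graph_def
              intro!: bexI[of _ "ranked S i"] bexI[of _ "f (ranked S i)"])
      next
        case 2
        then show ?thesis
          using up[OF 2(1)] gmaps[OF 2(1)] maps[of "ranked S j"] S(2)
          by (auto simp: contraction_def fiber_def V parent_graph_def
              intro!: bexI[of _ "f (ranked S j)"] bexI[of _ "ranked S j"])
      qed
    qed
  qed simp
  moreover have "card (pverts (parent_graph ({1..n} - {n}) n g)) = n"
  proof -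
    have "insert n ({1..n} - {n}) = {1..n}" using n by auto
    then show ?thesis by (simp add: parent_graph_def)
  qed
  moreover have "q \<in> ?V \<rightarrow>\<^sub>E S" using p by (auto simp: q_def)
  moreover have "\<forall>r\<in>S. q r = r" using S(1) q by auto
  ultimately have "is_display (parent_graph ({1..n} - {n}) n g) ?U (S, q)"
    using S(1,2) conn by (auto simp: is_display_def V)
  then show ?thesis unfolding displayed_in_def by blast
qed

section \<open>The support count\<close>

lemma labeled_trees_size:
  assumes "T \<in> labeled_trees n"
  shows "n \<ge> 1"
proof -
  have T: "pverts T = {1..n}" "undirected_tree T" using assms by (auto simp: labeled_trees_def)
  then have "pverts T \<noteq> {}"
    by (auto simp: undirected_tree_def Digraph_Component.connected_def
        strongly_connected_def mk_symmetric_def)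
  then show ?thesis using T(1) by (cases n) auto
qed

lemma labeled_trees_eq:
  assumes "m \<ge> 1"
  shows "labeled_trees m = parent_graph ({1..m} - {m}) m ` forests ({1..m} - {m}) {m}"
proof (intro equalityI subsetI)
  fix U assume U: "U \<in> labeled_trees m"
  then obtain f where "f \<in> forests (pverts U - {m}) {m}" "U = parent_graph (pverts U - {m}) m f"
    using undirected_tree_is_parent_graph[of U m] assms by (auto simp: labeled_trees_def)
  then show "U \<in> parent_graph ({1..m} - {m}) m ` forests ({1..m} - {m}) {m}"
    using U by (auto simp: labeled_trees_def)
next
  fix U assume "U \<in> parent_graph ({1..m} - {m}) m ` forests ({1..m} - {m}) {m}"
  then obtain f where f: "f \<in> forests ({1..m} - {m}) {m}" "U = parent_graph ({1..m} - {m}) m f" by blast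
  have "insert m ({1..m} - {m}) = {1..m}" using assms by auto
  then have "pverts U = {1..m}" using f(2) by (simp add: parent_graph_def)
  then show "U \<in> labeled_trees m"
    using f undirected_tree_parent_graph[OF f(1)] by (simp add: labeled_trees_def)
qed

lemma card_labeled_trees:
  assumes "m \<ge> 1"
  shows "card (labeled_trees m) = m ^ (m - 2)"
proof -
  let ?A = "{1..m} - {m}"
  have A: "card ?A = m - 1" using assms by simp
  have "card (labeled_trees m) = card (forests ?A {m})"
    unfolding labeled_trees_eq[OF assms] by (intro card_image inj_on_parent_graph) simp
  also have "\<dots> = (if ?A = {} then 1 else (m - 1 + 1) ^ (m - 1 - 1))"
    using card_forests[of ?A "{m}"] A by simp
  also have "\<dots> = m ^ (m - 2)"
  proof (cases "?A = {}")
    case True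
    then have "m = 1" using A assms by (metis card.empty diff_is_0_eq le_antisym)
    then show ?thesis by simp
  next
    case False
    have "m - 1 + 1 = m" "m - 1 - 1 = m - 2" using assms by auto
    then show ?thesis using False by (simp only: if_False)
  qed
  finally show ?thesis .
qed

lemma card_trees_without_display:
  assumes T: "T \<in> labeled_trees n" and m: "m \<ge> 1"
  shows "card {U \<in> labeled_trees m. \<not> T \<preceq> U} \<le> avoider_bound n (m - 1)"
proof -
  have n: "n \<ge> 1" using T by (rule labeled_trees_size)
  then obtain g where g: "g \<in> forests ({1..n} - {n}) {n}" "T = parent_graph ({1..n} - {n}) n g"
    using T labeled_trees_eq by blast
  interpret pattern n "\<lambda>S. ranked S n" "shape_parent n g" using g(1) n by (rule pattern_shape)
  let ?A = "{1..m} - {m}"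
  have "{U \<in> labeled_trees m. \<not> T \<preceq> U} \<subseteq> parent_graph ?A m ` avoiders ?A m"
  proof
    fix U assume U: "U \<in> {U \<in> labeled_trees m. \<not> T \<preceq> U}"
    then obtain f where f: "f \<in> forests ?A {m}" "U = parent_graph ?A m f"
      using labeled_trees_eq[OF m] by blast
    have "\<not> pendant_copy ?A f S" for S
    proof
      assume "pendant_copy ?A f S"
      then have "T \<preceq> U" unfolding g(2) f(2) by (intro pendant_copy_displayed[OF g(1) n f(1)]) auto
      then show False using U by simp
    qed
    then show "U \<in> parent_graph ?A m ` avoiders ?A m" using f by (auto simp: avoiders_def)
  qed
  then have "card {U \<in> labeled_trees m. \<not> T \<preceq> U} \<le> card (avoiders ?A m)"
    by (intro surj_card_le finite_avoiders) auto
  also have "\<dots> \<le> avoider_bound n (card ?A)" by (rule card_avoiders_le) auto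
  finally show ?thesis using m by simp
qed

theorem theorem1p5:
  fixes n :: nat and T :: "nat pair_pre_digraph"
  assumes "T \<in> labeled_trees n"
  shows "\<exists>c::real. c > 0 \<and>
           (\<forall>m\<ge>1. 0 \<le> 1 - real (\<mu> T m) / real m ^ (m - 2)) \<and>
           (\<lambda>m. 1 - real (\<mu> T m) / real m ^ (m - 2)) \<in> O(\<lambda>m. exp (- c * real m))"
proof -
  let ?bad = "\<lambda>m. card {U \<in> labeled_trees m. \<not> T \<preceq> U}"
  have n: "n \<ge> 1" using assms by (rule labeled_trees_size)
  have ratio: "1 - real (\<mu> T m) / real m ^ (m - 2) = real (?bad m) / real m ^ (m - 2)" if m: "m \<ge> 1" for m
  proof -
    have fin: "finite (labeled_trees m)" using card_labeled_trees[OF m] m by (auto intro: card_ge_0_finite)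
    have "card (labeled_trees m) = \<mu> T m + ?bad m"
      unfolding support_count_def
      by (subst card_Un_disjoint[symmetric]) (auto intro!: arg_cong[where f = card] intro: finite_subset[OF _ fin])
    then have "real m ^ (m - 2) = real (\<mu> T m) + real (?bad m)"
      using card_labeled_trees[OF m] by (metis of_nat_add of_nat_power)
    moreover have "real m ^ (m - 2) > 0" using m by simp
    ultimately show ?thesis by (simp add: field_simps)
  qed
  obtain x where x: "x > exp (- 1)" "\<And>a. real (avoider_bound n a) * x ^ a / fact a \<le> exp 1"
    using avoider_bound_growth[OF n] by blast
  have "x > 0" using x(1) by (metis exp_gt_zero less_trans)
  define c where "c = (ln x + 1) / 2"
  have "ln x > - 1" using x(1) \<open>x > 0\<close> by (metis exp_less_cancel_iff exp_ln)
  then have c: "c > 0" by (simp add: c_def)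
  have "2 * c = ln x + 1" by (simp add: c_def)
  then have x_eq: "x = exp (2 * c - 1)" using \<open>x > 0\<close> by simp
  \<comment> \<open>Cayley's formula has \<open>m ^ (m - 2)\<close> where the estimate of \<open>fact m\<close> yields \<open>m * m ^ m\<close>, and \<open>fact (m - 1)\<close> saves one factor \<open>m\<close>; the remaining \<open>m\<^sup>2\<close> costs half of the exponent \<open>2 * c\<close>, through \<open>t\<^sup>2 / 2 \<le> exp t\<close> at \<open>t = c * m\<close>.\<close>
  define K where "K = exp 2 * x * (2 / c\<^sup>2)"
  have bound: "real (?bad m) / real m ^ (m - 2) \<le> K * exp (- c * real m)" if m: "m \<ge> 2" for m
  proof -
    obtain k where "m = k + 2" using m by (metis le_add_diff_inverse2)
    then have pow: "y ^ m = y ^ (m - 2) * y\<^sup>2" "y ^ m = y ^ (m - 1) * y" for y :: real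
      by (simp_all add: power_add power2_eq_square)
    have "fact m = real m * fact (m - 1)" using m by (simp add: fact_reduce)
    have "real (?bad m) \<le> real (avoider_bound n (m - 1))"
      using card_trees_without_display[OF assms, of m] m by simp
    also have "\<dots> \<le> exp 1 * fact (m - 1) / x ^ (m - 1)"
      using x(2)[of "m - 1"] \<open>x > 0\<close> by (simp add: field_simps)
    finally have "real (?bad m) * real m \<le> exp 1 * fact (m - 1) / x ^ (m - 1) * real m"
      by (rule mult_right_mono) simp
    also have "\<dots> = exp 1 * x * fact m / x ^ m"
      using \<open>x > 0\<close> by (simp add: pow(2)[of x] \<open>fact m = _\<close>)
    also have "\<dots> \<le> exp 1 * x * (exp 1 * real m * real m ^ m * exp (- real m)) / x ^ m"
      using \<open>x > 0\<close> m fact_le_Stirling[of m] by (intro divide_right_mono mult_left_mono) auto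
    also have "x ^ m = exp (2 * c * real m) * exp (- real m)"
      unfolding x_eq by (simp add: algebra_simps flip: exp_of_nat_mult exp_add)
    also have "exp 1 * x * (exp 1 * real m * real m ^ m * exp (- real m)) / (exp (2 * c * real m) * exp (- real m))
        = exp 2 * x * real m ^ 2 * exp (- 2 * c * real m) * real m ^ (m - 2) * real m"
      by (simp add: pow(1)[of "real m"] exp_minus field_simps flip: exp_add)
    finally have "real (?bad m) \<le> exp 2 * x * real m ^ 2 * exp (- 2 * c * real m) * real m ^ (m - 2)"
      using m by simp
    then have 1: "real (?bad m) / real m ^ (m - 2) \<le> exp 2 * x * (real m ^ 2 * exp (- 2 * c * real m))"
      using m by (simp add: pos_divide_le_eq mult_ac)
    have "(c * real m)\<^sup>2 / 2 \<le> exp (c * real m)"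
      using exp_lower_Taylor_quadratic[of "c * real m"] c by (smt (verit) mult_nonneg_nonneg of_nat_0_le_iff)
    then have "real m ^ 2 \<le> 2 / c\<^sup>2 * exp (c * real m)"
      using c by (simp add: field_simps power_mult_distrib)
    then have "real m ^ 2 * exp (- 2 * c * real m) \<le> 2 / c\<^sup>2 * exp (c * real m) * exp (- 2 * c * real m)"
      by (rule mult_right_mono) simp
    also have "\<dots> = 2 / c\<^sup>2 * exp (- c * real m)" by (simp add: mult.assoc flip: exp_add)
    finally have "exp 2 * x * (real m ^ 2 * exp (- 2 * c * real m)) \<le> exp 2 * x * (2 / c\<^sup>2 * exp (- c * real m))"
      using \<open>x > 0\<close> by (intro mult_left_mono) auto
    then show ?thesis using 1 by (simp add: K_def mult.assoc)
  qed
  have "(\<lambda>m. 1 - real (\<mu> T m) / real m ^ (m - 2)) \<in> O(\<lambda>m. exp (- c * real m))"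
  proof (rule bigoI[of _ K])
    show "\<forall>\<^sub>F m in at_top. norm (1 - real (\<mu> T m) / real m ^ (m - 2)) \<le> K * norm (exp (- c * real m))"
      using eventually_ge_at_top[of 2]
    proof eventually_elim
      case (elim m)
      then show ?case using ratio[of m] bound[OF elim] by simp
    qed
  qed
  moreover have "0 \<le> 1 - real (\<mu> T m) / real m ^ (m - 2)" if "m \<ge> 1" for m
    unfolding ratio[OF that] by simp
  ultimately show ?thesis using c by blast
qed

end
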